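(* Let $\Psi_{\mathbf{HGP}}:\mathbf{HGP}\to QSym$ be the linear map sending a hypergraphic polytope $\mathfrak{q}\subseteq\mathbb{R}^n$ to $\Psi_{\mathbf{HGP}}(\mathfrak{q})=\sum_f\prod_{i=1}^n x_{f(i)}$, the sum running over all $\mathfrak{q}$-generic functions $f:[n]\to\mathbb{N}$. Then the linear space $\ker\Psi_{\mathbf{HGP}}$ is generated (spanned) by the simple relations, the modular relations and the isomorphism relations on hypergraphic polytopes. The image of $\Psi_{\mathbf{HGP}}$ is $QSym$.
   Context: $\mathbb{K}$ is a field of characteristic zero; $\mathbb{N}=\{1,2,\dots\}$, $[n]=\{1,\dots,n\}$. $QSym$ is the $\mathbb{K}$-algebra of quasisymmetric functions in the commuting variables $x_1,x_2,\dots$. Polytopes. For non-empty $J\subseteq[n]$ let $\mathfrak{s}_J=\mathrm{conv}\{e_j : j\in J\}\subseteq\mathbb{R}^n$. A hypergraphic polytope in $\mathbb{R}^n$ is a Minkowski sum $\mathfrak{q}=\sum_{\emptyset\ne J\subseteq[n]}a_J\mathfrak{s}_J$ with real $a_J\ge0$ (the empty sum is $\{0\}$). The $a_J$ are determined by $\mathfrak{q}$, and $\mathcal{F}(\mathfrak{q})=\{J : a_J>0\}$. For a family $\mathcal{A}$ of non-empty subsets of $[n]$, $\mathcal{F}^{-1}(\mathcal{A})=\sum_{J\in\mathcal{A}}\mathfrak{s}_J$. $\mathbf{HGP}=\bigoplus_{n\ge0}\mathbf{HGP}_n$, with $\mathbf{HGP}_n$ the $\mathbb{K}$-vector space freely generated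 by the hypergraphic polytopes in $\mathbb{R}^n$. A function $f:[n]\to\mathbb{N}$ is $\mathfrak{q}$-generic if the face of $\mathfrak{q}$ on which $x\mapsto\sum_i f(i)x_i$ is minimized is a point. Set compositions. $\mathbf{C}_n$ is the set of set compositions $\vec{\boldsymbol{\pi}}=S_1|\cdots|S_k$ of $[n]$ (ordered lists of non-empty disjoint sets with union $[n]$). For non-empty $A\subseteq[n]$, $A_{\vec{\boldsymbol{\pi}}}=A\cap S_i$ with $i$ the smallest index such that $A\cap S_i\neq\emptyset$. Relations. A simple relation is $\mathfrak{q}_1-\mathfrak{q}_2\in\mathbf{HGP}$ (formal difference) with $\mathfrak{q}_1,\mathfrak{q}_2$ hypergraphic polytopes in the same $\mathbb{R}^n$ and $\mathcal{F}(\mathfrak{q}_1)=\mathcal{F}(\mathfrak{q}_2)$. For non-empty $A\subseteq[n]$ let $\mathrm{Orth}\,A=\{\vec{\boldsymbol{\pi}}\in\mathbf{C}_n : \#A_{\vec{\boldsymbol{\pi}}}=1\}$. Given disjoint families $\mathcal{A},\mathcal{B}$ of non-empty subsets of $[n]$ with $\bigcup_{A\in\mathcal{A}}(\mathrm{Orth}\,A)^c\cup\bigcup_{B\in\mathcal{B}}\mathrm{Orth}\,B=\mathbf{C}_n$, the corresponding modular relation is the formal linear combination $\sum_{\mathcal{T}\subseteq\mathcal{B}}(-1)^{\#\mathcal{T}}\big[\mathcal{F}^{-1}(\mathcal{A})+\mathcal{F}^{-1}(\mathcal{T})\big]\in\mathbf{HGP}_n$, where the sum inside the brackets is a Minkowski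 sum. An isomorphism relation is $\mathfrak{q}_1-\mathfrak{q}_2\in\mathbf{HGP}$ where $\mathfrak{q}_1,\mathfrak{q}_2$ are hypergraphic polytopes in the same $\mathbb{R}^n$ and $\mathfrak{q}_1$ is obtained from $\mathfrak{q}_2$ by a permutation of the coordinates. *)

theory Defs
  imports
    "HOL-Analysis.Convex"
    "HOL-Library.Function_Algebras"
    "HOL-Library.Poly_Mapping"
    "HOL-Library.Disjoint_Sets"
    "HOL-Combinatorics.Permutations"
begin

text \<open>
  The dimension \<open>n\<close> varies inside \<open>HGP\<close>, so \<open>\<real>^n\<close> is rendered as the subspace of those
  \<open>x :: nat \<Rightarrow> real\<close> that vanish outside \<open>{1..n}\<close>.  The following instance provides
  \<open>convex hull\<close> on this type; \<open>+\<close> and \<open>\<Sum>\<close> on sets of points are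
  Minkowski sums, the empty one being \<open>{0}\<close>.
\<close>

instantiation "fun" :: (type, real_vector) real_vector
begin

definition scaleR_fun :: "real \<Rightarrow> ('a \<Rightarrow> 'b) \<Rightarrow> 'a \<Rightarrow> 'b"
  where "scaleR_fun c x = (\<lambda>i. c *\<^sub>R x i)"

instance
  by standard (auto simp: scaleR_fun_def fun_eq_iff algebra_simps)

end

type_synonym point = "nat \<Rightarrow> real"

definition unit_vec :: "nat \<Rightarrow> point"
  where "unit_vec j = (\<lambda>i. if i = j then 1 else 0)"

definition simplex_on :: "nat set \<Rightarrow> point set"
  where "simplex_on J = convex hull (unit_vec ` J)"

definition nonempty_subsets :: "nat \<Rightarrow> nat set set"
  where "nonempty_subsets n = {J. J \<subseteq> {1..n} \<and> J \<noteq> {}}"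

definition simplex_comb :: "nat \<Rightarrow> (nat set \<Rightarrow> real) \<Rightarrow> point set"
  where "simplex_comb n a = (\<Sum>J\<in>nonempty_subsets n. (*\<^sub>R) (a J) ` simplex_on J)"

definition hypergraphic :: "nat \<Rightarrow> point set \<Rightarrow> bool"
  where "hypergraphic n q \<longleftrightarrow> (\<exists>a. (\<forall>J\<in>nonempty_subsets n. 0 \<le> a J) \<and> q = simplex_comb n a)"

text \<open>
  The coefficients of a hypergraphic polytope; they are well defined by the lemma
  \<open>hgp_coeffs_simplex_comb\<close> below.
\<close>

definition hgp_coeffs :: "nat \<Rightarrow> point set \<Rightarrow> nat set \<Rightarrow> real"
  where "hgp_coeffs n q = (THE a. a \<in> nonempty_subsets n \<rightarrow>\<^sub>E {0..} \<and> q = simplex_comb n a)"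

definition hgp_family :: "nat \<Rightarrow> point set \<Rightarrow> nat set set"
  where "hgp_family n q = {J \<in> nonempty_subsets n. hgp_coeffs n q J > 0}"

definition family_polytope :: "nat set set \<Rightarrow> point set"
  where "family_polytope \<A> = (\<Sum>J\<in>\<A>. simplex_on J)"

context
begin

private definition is_min :: "(point \<Rightarrow> real) \<Rightarrow> point set \<Rightarrow> real \<Rightarrow> bool"
  where "is_min h X c \<longleftrightarrow> (\<exists>x\<in>X. h x = c) \<and> (\<forall>x\<in>X. c \<le> h x)"

private lemma is_min_unique: "is_min h X c \<Longrightarrow> is_min h X d \<Longrightarrow> c = d"
  unfolding is_min_def by (metis order_antisym)

private lemma is_min_sum:
  assumes "finite A" "linear h" "\<And>J. J \<in> A \<Longrightarrow> is_min h (X J) (c J)"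
  shows "is_min h (\<Sum>J\<in>A. X J) (\<Sum>J\<in>A. c J)"
  using assms(1,3)
proof (induction A rule: finite_induct)
  case empty
  then show ?case using linear_0[OF assms(2)] by (simp add: is_min_def)
next
  case (insert J A)
  then have "is_min h (X J) (c J)" "is_min h (\<Sum>J\<in>A. X J) (\<Sum>J\<in>A. c J)" by auto
  then show ?case using insert(1,2)
    by (auto simp: is_min_def set_plus_def linear_add[OF assms(2)] intro!: add_mono)
      (metis linear_add[OF assms(2)])
qed

private lemma linear_coord_sum: "linear (\<lambda>x::point. \<Sum>i\<in>S. x i)"
  by (rule linearI) (auto simp: sum.distrib scaleR_fun_def sum_distrib_left)

private lemma is_min_simplex:
  assumes "J \<noteq> {}" "finite S" "0 \<le> a"
  shows "is_min (\<lambda>x. \<Sum>i\<in>S. x i) ((*\<^sub>R) a ` simplex_on J) (if J \<subseteq> S then a else 0)"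
proof -
  let ?h = "\<lambda>x::point. \<Sum>i\<in>S. x i"
  let ?c = "if J \<subseteq> S then 1 else 0 :: real"
  have e: "?h (unit_vec j) = (if j \<in> S then 1 else 0)" for j
    using assms(2) by (simp add: unit_vec_def)
  have cv: "convex {x. ?c \<le> ?h x}"
    unfolding convex_def
  proof (intro ballI allI impI, unfold mem_Collect_eq)
    fix x y :: point and u v :: real
    assume *: "?c \<le> ?h x" "?c \<le> ?h y" "0 \<le> u" "0 \<le> v" "u + v = 1"
    have "?c = u * ?c + v * ?c" using *(5) by (simp flip: distrib_right)
    also have "\<dots> \<le> u * ?h x + v * ?h y"
      using * by (intro add_mono mult_left_mono)
    finally show "?c \<le> ?h (u *\<^sub>R x + v *\<^sub>R y)"
      by (simp add: sum.distrib scaleR_fun_def sum_distrib_left)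
  qed
  have sub: "simplex_on J \<subseteq> {x. ?c \<le> ?h x}"
    unfolding simplex_on_def using cv by (intro hull_minimal) (auto simp: e)
  obtain j where j: "j \<in> J" "?h (unit_vec j) = ?c"
  proof (cases "J \<subseteq> S")
    case True
    then show ?thesis using assms(1) that e by (metis all_not_in_conv subsetD)
  next
    case False
    then show ?thesis using that e by (metis subsetI)
  qed
  have uj: "unit_vec j \<in> simplex_on J"
    unfolding simplex_on_def using j(1) by (intro hull_inc) auto
  have hs: "?h (a *\<^sub>R x) = a * ?h x" for x
    by (simp add: scaleR_fun_def sum_distrib_left)
  have c: "(if J \<subseteq> S then a else 0) = a * ?c" by simp
  show ?thesis
    unfolding is_min_def c
  proof (intro conjI ballI)
    show "\<exists>x\<in>(*\<^sub>R) a ` simplex_on J. ?h x = a * ?c"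
      using uj j(2) hs[of "unit_vec j"] by (metis imageI)
  next
    fix x assume "x \<in> (*\<^sub>R) a ` simplex_on J"
    then obtain y where y: "y \<in> simplex_on J" "x = a *\<^sub>R y" by auto
    show "a * ?c \<le> ?h x"
      unfolding y(2) hs using subsetD[OF sub y(1)] assms(3) by (intro mult_left_mono) simp_all
  qed
qed

lemma finite_nonempty_subsets: "finite (nonempty_subsets n)"
  unfolding nonempty_subsets_def by (rule finite_subset[of _ "Pow {1..n}"]) auto

lemma simplex_comb_inject:
  assumes a: "\<And>J. J \<in> nonempty_subsets n \<Longrightarrow> 0 \<le> a J"
    and b: "\<And>J. J \<in> nonempty_subsets n \<Longrightarrow> 0 \<le> b J"
    and eq: "simplex_comb n a = simplex_comb n b"
    and S: "S \<in> nonempty_subsets n"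
  shows "a S = b S"
proof -
  let ?N = "nonempty_subsets n"
  have m: "is_min (\<lambda>x. \<Sum>i\<in>S. x i) (simplex_comb n a) (\<Sum>J\<in>?N. if J \<subseteq> S then a J else 0)"
    if "\<And>J. J \<in> ?N \<Longrightarrow> 0 \<le> a J" "S \<in> ?N" for a S
    unfolding simplex_comb_def using that
    by (intro is_min_sum[OF finite_nonempty_subsets linear_coord_sum] is_min_simplex)
      (auto simp: nonempty_subsets_def intro: finite_subset)
  have key: "(\<Sum>J\<in>?N. if J \<subseteq> S then a J else 0) = (\<Sum>J\<in>?N. if J \<subseteq> S then b J else 0)"
    if "S \<in> ?N" for S
    using m[of a S] m[of b S] a b that eq is_min_unique by metis
  have fin: "finite S" using S by (auto simp: nonempty_subsets_def intro: finite_subset)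
  then show ?thesis using S
  proof (induction S rule: finite_psubset_induct)
    case (psubset S)
    have split: "(\<Sum>J\<in>?N. if J \<subseteq> S then c J else 0)
        = c S + (\<Sum>J\<in>?N - {S}. if J \<subseteq> S then c J else 0)" for c :: "nat set \<Rightarrow> real"
      using sum.remove[OF finite_nonempty_subsets psubset.prems,
          of "\<lambda>J. if J \<subseteq> S then c J else 0"] by simp
    have "(\<Sum>J\<in>?N - {S}. if J \<subseteq> S then a J else 0) = (\<Sum>J\<in>?N - {S}. if J \<subseteq> S then b J else 0)"
      using psubset.IH by (intro sum.cong) auto
    then show ?case using key[OF psubset.prems] split[of a] split[of b] by simp
  qed
qed

lemma hgp_coeffs_simplex_comb:
  assumes "a \<in> nonempty_subsets n \<rightarrow>\<^sub>E {0..}"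
  shows "hgp_coeffs n (simplex_comb n a) = a"
  unfolding hgp_coeffs_def
proof (rule the_equality)
  fix b assume b: "b \<in> nonempty_subsets n \<rightarrow>\<^sub>E {0..} \<and> simplex_comb n a = simplex_comb n b"
  have "b J = a J" if "J \<in> nonempty_subsets n" for J
    using simplex_comb_inject[of n b a J] assms b that by (force simp: PiE_def Pi_def)
  then show "b = a" using assms b by (intro PiE_ext) auto
qed (use assms in auto)

end

text \<open>
  A basis element is a pair of an ambient dimension and a hypergraphic polytope; the dimension
  is recorded because \<open>{0}\<close> and the like are hypergraphic in several \<open>\<real>^n\<close>.
\<close>

type_synonym 'k hgp_comb = "(nat \<times> point set) \<Rightarrow>\<^sub>0 'k"

definition HGP :: "'k::zero hgp_comb set"
  where "HGP = {v. Poly_Mapping.keys v \<subseteq> {(n, q). hypergraphic n q}}"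

definition hgp_scale :: "'k::field \<Rightarrow> 'k hgp_comb \<Rightarrow> 'k hgp_comb"
  where "hgp_scale c v = Poly_Mapping.map ((*) c) v"

lemma lookup_hgp_scale: "Poly_Mapping.lookup (hgp_scale c v) b = c * Poly_Mapping.lookup v b"
  unfolding hgp_scale_def by transfer (simp add: when_def)

global_interpretation hgp: vector_space hgp_scale
  by standard (auto intro!: poly_mapping_eqI simp: lookup_hgp_scale lookup_add algebra_simps)

text \<open>
  A monomial in \<open>x\<^sub>1, x\<^sub>2, \<dots>\<close> is a finitely supported exponent function that vanishes at the
  (unused) index \<open>0\<close>; a formal power series is its function of coefficients.
\<close>

type_synonym monomial = "nat \<Rightarrow>\<^sub>0 nat"
type_synonym 'k series = "monomial \<Rightarrow> 'k"

definition monomial_of :: "nat list \<Rightarrow> nat list \<Rightarrow> monomial"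
  where "monomial_of is as = (\<Sum>l<length is. Poly_Mapping.single (is ! l) (as ! l))"

definition QSym :: "'k::field_char_0 series set"
  where "QSym = {F.
     (\<forall>m. 0 \<in> Poly_Mapping.keys m \<longrightarrow> F m = 0) \<and>
     (\<exists>d. \<forall>m. F m \<noteq> 0 \<longrightarrow> (\<Sum>i\<in>Poly_Mapping.keys m. Poly_Mapping.lookup m i) \<le> d) \<and>
     (\<forall>is js as. length is = length as \<and> length js = length as \<and> 0 \<notin> set as \<and>
        0 \<notin> set is \<and> 0 \<notin> set js \<and> sorted_wrt (<) is \<and> sorted_wrt (<) js
        \<longrightarrow> F (monomial_of is as) = F (monomial_of js as))}"

definition series_scale :: "'k::field \<Rightarrow> 'k series \<Rightarrow> 'k series"
  where "series_scale c F = (\<lambda>m. c * F m)"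

global_interpretation series: vector_space series_scale
  by standard (auto simp: series_scale_def fun_eq_iff algebra_simps)

definition min_face :: "nat \<Rightarrow> (nat \<Rightarrow> nat) \<Rightarrow> point set \<Rightarrow> point set"
  where "min_face n f q =
    {x \<in> q. \<forall>y\<in>q. (\<Sum>i=1..n. real (f i) * x i) \<le> (\<Sum>i=1..n. real (f i) * y i)}"

definition generic :: "nat \<Rightarrow> point set \<Rightarrow> (nat \<Rightarrow> nat) \<Rightarrow> bool"
  where "generic n q f \<longleftrightarrow> (\<exists>p. min_face n f q = {p})"

text \<open>
  The coefficient of \<open>m\<close> in \<open>\<Sum>\<^sub>f \<Prod>\<^sub>i x\<^bsub>f(i)\<^esub>\<close> is the number of generic \<open>f : [n] \<rightarrow> {1,2,\<dots>}\<close>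
  with \<open>\<Prod>\<^sub>i x\<^bsub>f(i)\<^esub> = m\<close>; it is finite by the lemma \<open>finite_generic_with\<close>.
\<close>

definition generic_with :: "nat \<Rightarrow> point set \<Rightarrow> monomial \<Rightarrow> (nat \<Rightarrow> nat) set"
  where "generic_with n q m = {f \<in> {1..n} \<rightarrow>\<^sub>E {1..}.
    generic n q f \<and> (\<Sum>i=1..n. Poly_Mapping.single (f i) 1) = m}"

lemma finite_generic_with: "finite (generic_with n q m)"
proof (rule finite_subset)
  show "generic_with n q m \<subseteq> {1..n} \<rightarrow>\<^sub>E Poly_Mapping.keys m"
  proof
    fix f assume f: "f \<in> generic_with n q m"
    have "f i \<in> Poly_Mapping.keys m" if i: "i \<in> {1..n}" for i
    proof -
      have "Poly_Mapping.lookup m (f i) = (\<Sum>j=1..n. Poly_Mapping.lookup (Poly_Mapping.single (f j) (1::nat)) (f i))"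
        using f unfolding generic_with_def by (auto simp flip: lookup_sum)
      also have "\<dots> \<ge> Poly_Mapping.lookup (Poly_Mapping.single (f i) (1::nat)) (f i)"
        using i by (intro member_le_sum) auto
      finally show ?thesis by (simp add: in_keys_iff)
    qed
    then show "f \<in> {1..n} \<rightarrow>\<^sub>E Poly_Mapping.keys m"
      using f by (auto simp: generic_with_def PiE_def)
  qed
qed (simp add: finite_PiE)

definition Psi_polytope :: "nat \<Rightarrow> point set \<Rightarrow> 'k::field_char_0 series"
  where "Psi_polytope n q = (\<lambda>m. of_nat (card (generic_with n q m)))"

definition Psi :: "'k::field_char_0 hgp_comb \<Rightarrow> 'k series"
  where "Psi v = (\<Sum>(n, q)\<in>Poly_Mapping.keys v.
    series_scale (Poly_Mapping.lookup v (n, q)) (Psi_polytope n q))"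

lemma Psi_single: "Psi (Poly_Mapping.single (n, q) 1) = Psi_polytope n q"
  by (simp add: Psi_def series_scale_def)

lemma linear_Psi:
  "Vector_Spaces.linear hgp_scale series_scale (Psi :: 'k::field_char_0 hgp_comb \<Rightarrow> _)"
proof -
  have Psi_eq: "Psi v = (\<Sum>b\<in>B. series_scale (Poly_Mapping.lookup v b) (Psi_polytope (fst b) (snd b)))"
    if "finite B" "Poly_Mapping.keys v \<subseteq> B" for v :: "'k hgp_comb" and B
    unfolding Psi_def case_prod_beta prod.collapse using that
    by (intro sum.mono_neutral_left) (auto simp: in_keys_iff series_scale_def)
  have add: "Psi (v + w) = Psi v + Psi w" for v w :: "'k hgp_comb"
  proof -
    let ?B = "Poly_Mapping.keys v \<union> Poly_Mapping.keys w"
    have "Poly_Mapping.keys (v + w) \<subseteq> ?B" by (rule keys_add)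
    then show ?thesis
      by (simp add: Psi_eq[where B = ?B] lookup_add series.scale_left_distrib sum.distrib)
  qed
  have scale: "Psi (hgp_scale c v) = series_scale c (Psi v)" for c and v :: "'k hgp_comb"
  proof -
    let ?B = "Poly_Mapping.keys v"
    have "Poly_Mapping.keys (hgp_scale c v) \<subseteq> ?B" by (auto simp: in_keys_iff lookup_hgp_scale)
    then have "Psi (hgp_scale c v) = (\<Sum>b\<in>?B. series_scale c
        (series_scale (Poly_Mapping.lookup v b) (Psi_polytope (fst b) (snd b))))"
      by (simp add: Psi_eq[where B = ?B] lookup_hgp_scale)
    also have "\<dots> = series_scale c (Psi v)"
      by (simp add: Psi_eq[where B = ?B] series.scale_sum_right)
    finally show ?thesis .
  qed
  show ?thesis
    by unfold_locales (simp_all add: add scale)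
qed

definition set_compositions :: "nat \<Rightarrow> nat set list set"
  where "set_compositions n = {\<pi>. distinct \<pi> \<and> partition_on {1..n} (set \<pi>)}"

definition first_part :: "nat set \<Rightarrow> nat set list \<Rightarrow> nat set"
  where "first_part A \<pi> = A \<inter> \<pi> ! (LEAST i. i < length \<pi> \<and> A \<inter> \<pi> ! i \<noteq> {})"

definition Orth :: "nat \<Rightarrow> nat set \<Rightarrow> nat set list set"
  where "Orth n A = {\<pi> \<in> set_compositions n. card (first_part A \<pi>) = 1}"

definition simple_relations :: "'k::field_char_0 hgp_comb set"
  where "simple_relations = {Poly_Mapping.single (n, q\<^sub>1) 1 - Poly_Mapping.single (n, q\<^sub>2) 1 | n q\<^sub>1 q\<^sub>2.
    hypergraphic n q\<^sub>1 \<and> hypergraphic n q\<^sub>2 \<and> hgp_family n q\<^sub>1 = hgp_family n q\<^sub>2}"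

definition modular_relations :: "'k::field_char_0 hgp_comb set"
  where "modular_relations = {\<Sum>\<T>\<in>Pow \<B>.
      Poly_Mapping.single (n, family_polytope \<A> + family_polytope \<T>) ((-1) ^ card \<T>) | n \<A> \<B>.
    \<A> \<subseteq> nonempty_subsets n \<and> \<B> \<subseteq> nonempty_subsets n \<and> \<A> \<inter> \<B> = {} \<and>
    (\<Union>A\<in>\<A>. set_compositions n - Orth n A) \<union> (\<Union>B\<in>\<B>. Orth n B) = set_compositions n}"

definition isomorphism_relations :: "'k::field_char_0 hgp_comb set"
  where "isomorphism_relations = {Poly_Mapping.single (n, q\<^sub>1) 1 - Poly_Mapping.single (n, q\<^sub>2) 1 | n q\<^sub>1 q\<^sub>2.
    hypergraphic n q\<^sub>1 \<and> hypergraphic n q\<^sub>2 \<and>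
    (\<exists>\<sigma>. \<sigma> permutes {1..n} \<and> q\<^sub>1 = (\<lambda>x. x \<circ> \<sigma>) ` q\<^sub>2)}"

end

(*
  By Minkowski additivity a function f is generic for q iff f attains a unique minimum on every
  member of the family of q; write U f for the family of all sets on which f does. Modulo simple
  relations only the polytopes of families A matter, and these can be replaced by their Moebius
  inverses E A = sum over T disjoint from A of (-1)^|T| [A + T], whose image counts the functions
  f with U f = A. If there is no such f, then E A is a modular relation. Otherwise U f determines
  the composition of n formed by the sizes of the levels of f (although not the order of adjacent
  singleton levels), so E (U f) is sent to a nonzero multiple of a monomial quasisymmetric
  function, and functions with the same composition give elements E (U f) that differ by
  isomorphism relations. Hence one E per composition spans HGP modulo the relations, and the
  images of these form a basis of QSym.
*)
theory Submission
  imports Defs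
begin

section \<open>Generic functions of hypergraphic polytopes\<close>

text \<open>A function is seen only through the sets on which it has a unique minimum. A pair {i, j}
  detects whether f i = f j, and a set {i, j, k} with f j = f k and j different from k tells whether
  i lies below that tie. A set on which f is injective always belongs to the family, so exchanging
  two adjacent singleton levels leaves the family unchanged. This is the obstacle: several set
  compositions may share one family, and E (U f) does not isolate a single one of them. What rescues
  the argument is that the coefficient of E (U f) at the monomial of f counts functions, f among
  them; it is a positive integer and hence nonzero in characteristic zero. Modular relations speak
  of set compositions while the series speaks of functions. The two are linked by listing the level
  sets of a function by increasing value: the first block that meets J then carries the minimum of f
  on J.\<close>

definition unique_min_sets :: "nat \<Rightarrow> (nat \<Rightarrow> nat) \<Rightarrow> nat set set"
  where "unique_min_sets n f = {J \<in> nonempty_subsets n. \<exists>j\<in>J. \<forall>i\<in>J - {j}. f j < f i}"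

section \<open>Minimizing faces of Minkowski sums\<close>

definition minimizers :: "('a \<Rightarrow> 'b::linorder) \<Rightarrow> 'a set \<Rightarrow> 'a set"
  where "minimizers h X = {x \<in> X. \<forall>y\<in>X. h x \<le> h y}"

text \<open>The two summands vary independently: keeping one fixed and moving the other shows that a
  minimal sum has minimal parts.\<close>

lemma minimizers_plus:
  fixes h :: "'a::ab_group_add \<Rightarrow> real"
  assumes h: "\<And>x y. h (x + y) = h x + h y"
  shows "minimizers h (X + Y) = minimizers h X + minimizers h Y"
proof (intro equalityI subsetI)
  fix z assume "z \<in> minimizers h (X + Y)"
  then obtain x y where xy: "z = x + y" "x \<in> X" "y \<in> Y"
    and min: "\<And>x' y'. x' \<in> X \<Longrightarrow> y' \<in> Y \<Longrightarrow> h (x + y) \<le> h (x' + y')"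
    by (auto simp: minimizers_def elim!: set_plus_elim)
  have "h x \<le> h x'" if "x' \<in> X" for x' using min[OF that xy(3)] by (simp add: h)
  moreover have "h y \<le> h y'" if "y' \<in> Y" for y' using min[OF xy(2) that] by (simp add: h)
  ultimately show "z \<in> minimizers h X + minimizers h Y"
    using xy by (auto simp: minimizers_def)
qed (auto simp: minimizers_def set_plus_def h add_mono)

lemma minimizers_sum:
  fixes h :: "'a::ab_group_add \<Rightarrow> real"
  assumes h: "\<And>x y. h (x + y) = h x + h y" and "finite A"
  shows "minimizers h (\<Sum>J\<in>A. X J) = (\<Sum>J\<in>A. minimizers h (X J))"
  using assms(2)
  by (induction A rule: finite_induct) (auto simp: minimizers_plus[OF h], auto simp: minimizers_def)

text \<open>Translation by a fixed element of one summand embeds the other into the sum;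
  nonemptiness supplies that element.\<close>

lemma is_singleton_set_plus:
  fixes X Y :: "'a::ab_group_add set"
  assumes "X \<noteq> {}" "Y \<noteq> {}"
  shows "is_singleton (X + Y) \<longleftrightarrow> is_singleton X \<and> is_singleton Y"
proof
  assume "is_singleton (X + Y)"
  then obtain z where z: "X + Y = {z}" by (auto simp: is_singleton_def)
  obtain x y where xy: "x \<in> X" "y \<in> Y" using assms by auto
  have s: "x' + y' = z" if "x' \<in> X" "y' \<in> Y" for x' y' using z that by blast
  have "x' = x" if "x' \<in> X" for x' using s[OF that xy(2)] s[OF xy] by (metis add_right_cancel)
  moreover have "y' = y" if "y' \<in> Y" for y' using s[OF xy(1) that] s[OF xy] by (metis add_left_cancel)
  ultimately show "is_singleton X \<and> is_singleton Y" using xy by (auto intro!: is_singletonI')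
qed (auto simp: is_singleton_def set_plus_def)

text \<open>Nonemptiness of the sum is part of the conclusion because the induction step needs it
  for the binary case.\<close>

lemma is_singleton_set_sum:
  fixes X :: "'b \<Rightarrow> 'a::ab_group_add set"
  assumes "finite A" "\<And>J. J \<in> A \<Longrightarrow> X J \<noteq> {}"
  shows "(\<Sum>J\<in>A. X J) \<noteq> {} \<and> (is_singleton (\<Sum>J\<in>A. X J) \<longleftrightarrow> (\<forall>J\<in>A. is_singleton (X J)))"
  using assms
proof (induction A rule: finite_induct)
  case (insert J A)
  have "X J \<noteq> {}" "(\<Sum>J\<in>A. X J) \<noteq> {}" using insert by auto
  moreover from this have "X J + (\<Sum>J\<in>A. X J) \<noteq> {}" by (auto simp: set_plus_def)
  ultimately show ?case using insert by (simp add: is_singleton_set_plus)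
qed simp

lemma simplex_on_subset:
  assumes "finite J"
  shows "simplex_on J \<subseteq> {x. (\<forall>i. 0 \<le> x i) \<and> (\<forall>i. i \<notin> J \<longrightarrow> x i = 0) \<and> (\<Sum>i\<in>J. x i) = 1}"
  unfolding simplex_on_def
  by (intro hull_minimal)
    (auto simp: unit_vec_def assms convex_def scaleR_fun_def sum.distrib simp flip: sum_distrib_left)

lemma unit_vec_in_simplex_on: "j \<in> J \<Longrightarrow> unit_vec j \<in> simplex_on J"
  unfolding simplex_on_def by (intro hull_inc) auto

definition pairing :: "nat \<Rightarrow> (nat \<Rightarrow> nat) \<Rightarrow> point \<Rightarrow> real"
  where "pairing n f x = (\<Sum>i=1..n. real (f i) * x i)"

lemma pairing_add: "pairing n f (x + y) = pairing n f x + pairing n f y"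
  by (simp add: pairing_def sum.distrib distrib_left)

lemma pairing_scaleR: "pairing n f (c *\<^sub>R x) = c * pairing n f x"
  by (simp add: pairing_def scaleR_fun_def sum_distrib_left mult.left_commute)

lemma pairing_unit_vec: "j \<in> {1..n} \<Longrightarrow> pairing n f (unit_vec j) = f j"
  by (simp add: pairing_def unit_vec_def if_distrib cong: if_cong)

lemma unit_vec_inject: "unit_vec i = unit_vec j \<longleftrightarrow> i = j"
  by (auto simp: unit_vec_def fun_eq_iff split: if_splits)

text \<open>The coordinates of a point of the simplex sum to 1, so the constant can be moved inside.
  With c the minimum of f on J every term becomes nonnegative.\<close>

lemma pairing_simplex_on:
  assumes "J \<subseteq> {1..n}" "x \<in> simplex_on J"
  shows "pairing n f x - c = (\<Sum>j\<in>J. (real (f j) - c) * x j)"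
proof -
  have "finite J" using assms(1) finite_subset by blast
  note x = subsetD[OF simplex_on_subset[OF this] assms(2)]
  have "pairing n f x = (\<Sum>j\<in>J. real (f j) * x j)"
    unfolding pairing_def using assms(1) x by (intro sum.mono_neutral_right) auto
  then show ?thesis using x
    by (simp add: left_diff_distrib sum_subtractf flip: sum_distrib_left)
qed

text \<open>The minimizing face is spanned by the vertices \<open>unit_vec j\<close> at which f is
  minimal on J, so it is a point exactly when there is one such j. Nonemptiness is recorded for the
  passage to Minkowski sums.\<close>

lemma simplex_on_minimizers:
  assumes "J \<in> nonempty_subsets n"
  shows "minimizers (pairing n f) (simplex_on J) \<noteq> {}"
    and "is_singleton (minimizers (pairing n f) (simplex_on J)) \<longleftrightarrow> J \<in> unique_min_sets n f"
proof -
  have J: "J \<subseteq> {1..n}" "J \<noteq> {}" and fin: "finite J"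
    using assms by (auto simp: nonempty_subsets_def intro: finite_subset)
  note sx = subsetD[OF simplex_on_subset[OF fin]]
  have ge: "c \<le> pairing n f x" if "\<And>i. i \<in> J \<Longrightarrow> c \<le> f i" "x \<in> simplex_on J" for c x
  proof -
    have "0 \<le> (\<Sum>j\<in>J. (real (f j) - c) * x j)"
      using that sx by (intro sum_nonneg mult_nonneg_nonneg) auto
    then show ?thesis using pairing_simplex_on[OF J(1) that(2), of f c] by linarith
  qed
  have vert: "unit_vec j \<in> minimizers (pairing n f) (simplex_on J)"
    if "j \<in> J" "\<And>i. i \<in> J \<Longrightarrow> f j \<le> f i" for j
    using that ge[of "f j"] J(1) by (auto simp: minimizers_def unit_vec_in_simplex_on pairing_unit_vec subset_iff)
  obtain j where j: "j \<in> J" "\<And>i. i \<in> J \<Longrightarrow> f j \<le> f i"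
    using ex_min_if_finite[of "f ` J"] fin J(2) by (auto simp: not_less)
  then show "minimizers (pairing n f) (simplex_on J) \<noteq> {}" using vert by blast
  show "is_singleton (minimizers (pairing n f) (simplex_on J)) \<longleftrightarrow> J \<in> unique_min_sets n f"
  proof
    assume "is_singleton (minimizers (pairing n f) (simplex_on J))"
    then have "i = j" if "i \<in> J" "f i = f j" for i
      using vert[OF j] vert[of i] j that by (metis is_singletonE singletonD unit_vec_inject)
    then have "f j < f i" if "i \<in> J - {j}" for i
      using that j by (metis Diff_iff insertI1 order_le_less)
    then show "J \<in> unique_min_sets n f" using j assms by (auto simp: unique_min_sets_def)
  next
    assume "J \<in> unique_min_sets n f"
    then obtain j where j: "j \<in> J" "\<And>i. i \<in> J - {j} \<Longrightarrow> f j < f i"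
      by (auto simp: unique_min_sets_def)
    have le: "f j \<le> f i" if "i \<in> J" for i using j(2)[of i] that by (cases "i = j") auto
    have "x = unit_vec j" if x: "x \<in> minimizers (pairing n f) (simplex_on J)" for x
    proof -
      have xJ: "x \<in> simplex_on J" and "pairing n f x \<le> pairing n f (unit_vec j)"
        using x j by (auto simp: minimizers_def unit_vec_in_simplex_on)
      then have "pairing n f x \<le> f j" using j(1) J(1) by (auto simp: pairing_unit_vec subset_iff)
      \<comment> \<open>A sum of nonnegative terms that vanishes vanishes termwise; off j the factor
        f i - f j is positive, so all weight of x sits at j.\<close>
      with ge[of "f j", OF _ xJ] le have "(\<Sum>i\<in>J. (real (f i) - real (f j)) * x i) = 0"
        using pairing_simplex_on[OF J(1) xJ, of f "f j"] by (simp add: order_antisym)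
      moreover have "0 \<le> (real (f i) - real (f j)) * x i" if "i \<in> J" for i
        using le[OF that] sx[OF xJ] by auto
      ultimately have z: "(real (f i) - real (f j)) * x i = 0" if "i \<in> J" for i
        using sum_nonneg_eq_0_iff[OF fin, of "\<lambda>i. (real (f i) - real (f j)) * x i"] that by auto
      have x0: "x i = 0" if "i \<noteq> j" for i
        using z[of i] j(2)[of i] that sx[OF xJ] by (cases "i \<in> J") auto
      moreover have "x j = 1"
        using sx[OF xJ] x0 j(1) fin by (auto simp: sum.remove)
      ultimately show ?thesis by (auto simp: unit_vec_def fun_eq_iff)
    qed
    then have "minimizers (pairing n f) (simplex_on J) = {unit_vec j}"
      using vert[OF j(1) le] by blast
    then show "is_singleton (minimizers (pairing n f) (simplex_on J))" by simp
  qed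
qed

lemma minimizers_scaleR:
  fixes h :: "'a::real_vector \<Rightarrow> real"
  assumes "0 < c" "\<And>x. h (c *\<^sub>R x) = c * h x"
  shows "minimizers h ((*\<^sub>R) c ` X) = (*\<^sub>R) c ` minimizers h X"
  using assms by (auto simp: minimizers_def)

lemma generic_eq: "generic n q f \<longleftrightarrow> is_singleton (minimizers (pairing n f) q)"
  by (simp add: generic_def min_face_def minimizers_def pairing_def is_singleton_def)

text \<open>A summand with coefficient 0 collapses to the origin and imposes no condition; a
  positive dilation does not change whether a face is a point.\<close>

lemma generic_simplex_comb:
  assumes "\<And>J. J \<in> nonempty_subsets n \<Longrightarrow> 0 \<le> a J"
  shows "generic n (simplex_comb n a) f \<longleftrightarrow> {J \<in> nonempty_subsets n. 0 < a J} \<subseteq> unique_min_sets n f"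
proof -
  let ?M = "\<lambda>J. minimizers (pairing n f) ((*\<^sub>R) (a J) ` simplex_on J)"
  have M: "?M J \<noteq> {} \<and> (is_singleton (?M J) \<longleftrightarrow> (0 < a J \<longrightarrow> J \<in> unique_min_sets n f))"
    if J: "J \<in> nonempty_subsets n" for J
  proof (cases "a J = 0")
    case True
    have "simplex_on J \<noteq> {}" using J unit_vec_in_simplex_on by (auto simp: nonempty_subsets_def)
    then have "(*\<^sub>R) (a J) ` simplex_on J = {0}" by (auto simp: True)
    then show ?thesis using True by (auto simp: minimizers_def is_singleton_def)
  next
    case False
    then have "0 < a J" using assms[OF J] by simp
    then have "?M J = (*\<^sub>R) (a J) ` minimizers (pairing n f) (simplex_on J)"
      by (intro minimizers_scaleR) (auto simp: pairing_scaleR)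
    moreover have "is_singleton ((*\<^sub>R) (a J) ` X) \<longleftrightarrow> is_singleton X" for X :: "point set"
      using \<open>0 < a J\<close> by (auto simp: is_singleton_altdef card_image inj_on_def)
    ultimately show ?thesis using simplex_on_minimizers[OF J, of f] \<open>0 < a J\<close> by auto
  qed
  moreover have "minimizers (pairing n f) (simplex_comb n a) = (\<Sum>J\<in>nonempty_subsets n. ?M J)"
    unfolding simplex_comb_def by (intro minimizers_sum finite_nonempty_subsets pairing_add)
  ultimately show ?thesis
    unfolding generic_eq using is_singleton_set_sum[OF finite_nonempty_subsets, of n ?M] by auto
qed

section \<open>Families of hypergraphic polytopes and the action of permutations\<close>

lemma hypergraphicE:
  assumes "hypergraphic n q"
  obtains a where "a \<in> nonempty_subsets n \<rightarrow>\<^sub>E {0..}" "q = simplex_comb n a" "hgp_coeffs n q = a"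
proof -
  obtain b where b: "\<forall>J\<in>nonempty_subsets n. 0 \<le> b J" "q = simplex_comb n b"
    using assms by (auto simp: hypergraphic_def)
  \<comment> \<open>Uniqueness of \<open>hgp_coeffs\<close> holds among extensional functions, so
    the values outside \<open>nonempty_subsets n\<close> are normalized first.\<close>
  let ?a = "restrict b (nonempty_subsets n)"
  have "?a \<in> nonempty_subsets n \<rightarrow>\<^sub>E {0..}" using b by auto
  moreover have "q = simplex_comb n ?a" unfolding b simplex_comb_def by (intro sum.cong) auto
  ultimately show ?thesis using that hgp_coeffs_simplex_comb by blast
qed

lemma generic_hypergraphic:
  assumes "hypergraphic n q"
  shows "generic n q f \<longleftrightarrow> hgp_family n q \<subseteq> unique_min_sets n f"
proof -
  obtain a where a: "a \<in> nonempty_subsets n \<rightarrow>\<^sub>E {0..}" "q = simplex_comb n a" "hgp_coeffs n q = a"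
    using hypergraphicE[OF assms] .
  have "0 \<le> a J" if "J \<in> nonempty_subsets n" for J using PiE_mem[OF a(1) that] by simp
  then show ?thesis using generic_simplex_comb[of n a f] a(2,3) by (simp add: hgp_family_def)
qed

lemma family_polytope_eq:
  assumes "\<A> \<subseteq> nonempty_subsets n"
  shows "family_polytope \<A> = simplex_comb n (\<lambda>J\<in>nonempty_subsets n. if J \<in> \<A> then 1 else 0)"
proof -
  have "(*\<^sub>R) 0 ` simplex_on J = {0}" if J: "J \<in> nonempty_subsets n" for J
  proof -
    have "simplex_on J \<noteq> {}" using J unit_vec_in_simplex_on by (auto simp: nonempty_subsets_def)
    then show ?thesis by auto
  qed
  then show ?thesis
    unfolding family_polytope_def simplex_comb_def using assms finite_nonempty_subsets
    by (intro sum.mono_neutral_cong_left) auto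
qed

lemma
  assumes "\<A> \<subseteq> nonempty_subsets n"
  shows hypergraphic_family_polytope: "hypergraphic n (family_polytope \<A>)"
    and hgp_family_family_polytope: "hgp_family n (family_polytope \<A>) = \<A>"
proof -
  let ?a = "\<lambda>J\<in>nonempty_subsets n. if J \<in> \<A> then 1 else 0 :: real"
  show "hypergraphic n (family_polytope \<A>)"
    unfolding family_polytope_eq[OF assms] hypergraphic_def by (intro exI[of _ ?a]) auto
  have "hgp_coeffs n (simplex_comb n ?a) = ?a" by (intro hgp_coeffs_simplex_comb) auto
  then show "hgp_family n (family_polytope \<A>) = \<A>"
    using assms by (auto simp: hgp_family_def family_polytope_eq[OF assms])
qed

lemma family_polytope_Un:
  assumes "\<A> \<subseteq> nonempty_subsets n" "\<B> \<subseteq> nonempty_subsets n" "\<A> \<inter> \<B> = {}"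
  shows "family_polytope \<A> + family_polytope \<B> = family_polytope (\<A> \<union> \<B>)"
  using assms finite_subset[OF _ finite_nonempty_subsets] 
  by (simp add: family_polytope_def sum.union_disjoint)

lemma sum_image_additive:
  fixes g :: "'a::comm_monoid_add \<Rightarrow> 'b::comm_monoid_add"
  assumes "\<And>x y. g (x + y) = g x + g y" "g 0 = 0"
  shows "g ` (\<Sum>J\<in>A. X J) = (\<Sum>J\<in>A. g ` X J)"
proof (induction A rule: infinite_finite_induct)
  case (insert J A)
  have "g ` (Y + Z) = g ` Y + g ` Z" for Y Z
    by (force simp: set_plus_image assms(1) image_iff)
  then show ?case using insert by simp
qed (simp_all add: assms(2))

text \<open>Precomposition with \<sigma> sends \<open>unit_vec (\<sigma> j)\<close> to
  \<open>unit_vec j\<close>, so the action on points is inverse to the action on index sets; hence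
  the image family stands on the left.\<close>

lemma family_polytope_permute:
  assumes \<sigma>: "\<sigma> permutes {1..n}"
  shows "(\<lambda>x. x \<circ> \<sigma>) ` family_polytope ((`) \<sigma> ` \<A>) = family_polytope \<A>"
proof -
  let ?L = "\<lambda>x::point. x \<circ> \<sigma>"
  have inj: "inj \<sigma>" using \<sigma> permutes_inj by auto
  have "linear ?L" by (rule linearI) (auto simp: scaleR_fun_def fun_eq_iff)
  moreover have "?L (unit_vec (\<sigma> j)) = unit_vec j" for j
    using inj by (auto simp: unit_vec_def fun_eq_iff inj_def)
  ultimately have "?L ` simplex_on (\<sigma> ` J) = simplex_on J" for J
    unfolding simplex_on_def by (simp add: convex_hull_linear_image image_image)
  then have "(\<Sum>J\<in>\<A>. ?L ` simplex_on (\<sigma> ` J)) = family_polytope \<A>"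
    by (simp add: family_polytope_def)
  moreover have "inj_on ((`) \<sigma>) \<A>" using inj by (meson inj_image_eq_iff inj_onI)
  ultimately show ?thesis
    unfolding family_polytope_def
    by (subst sum_image_additive) (auto simp: fun_eq_iff sum.reindex)
qed

text \<open>The pairing is unchanged when function and point are both precomposed with \<sigma>, so
  minimizing faces correspond bijectively.\<close>

lemma generic_permute:
  assumes \<sigma>: "\<sigma> permutes {1..n}"
  shows "generic n ((\<lambda>x. x \<circ> \<sigma>) ` q) (f \<circ> \<sigma>) \<longleftrightarrow> generic n q f"
proof -
  have p: "pairing n (f \<circ> \<sigma>) (x \<circ> \<sigma>) = pairing n f x" for x
    using sum.permute[OF \<sigma>, of "\<lambda>i. real (f i) * x i"] by (simp add: pairing_def o_def)
  have "x \<circ> \<sigma> = y \<circ> \<sigma> \<longleftrightarrow> x = y" for x y :: point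
    using permutes_surj[OF \<sigma>] by (metis comp_apply ext surjD)
  then have inj: "inj (\<lambda>x::point. x \<circ> \<sigma>)" by (auto simp: inj_def)
  have "minimizers (pairing n (f \<circ> \<sigma>)) ((\<lambda>x. x \<circ> \<sigma>) ` q) = (\<lambda>x. x \<circ> \<sigma>) ` minimizers (pairing n f) q"
    by (auto simp: minimizers_def p)
  then show ?thesis
    unfolding generic_eq is_singleton_altdef by (simp add: card_image inj_on_subset[OF inj])
qed

section \<open>Set compositions\<close>

text \<open>Brings unique minima into the form of the cardinality condition in
  \<open>Orth\<close>.\<close>

lemma unique_min_sets_iff_card:
  assumes "J \<in> nonempty_subsets n"
  shows "J \<in> unique_min_sets n f \<longleftrightarrow> card {j \<in> J. \<forall>i\<in>J. f j \<le> f i} = 1"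
proof
  assume "J \<in> unique_min_sets n f"
  then obtain j where j: "j \<in> J" and lt: "\<And>i. i \<in> J \<Longrightarrow> i \<noteq> j \<Longrightarrow> f j < f i"
    by (auto simp: unique_min_sets_def)
  have "f j \<le> f i" if "i \<in> J" for i using lt[OF that] by (cases "i = j") auto
  moreover have "k = j" if "k \<in> J" "\<forall>i\<in>J. f k \<le> f i" for k
    using lt[OF that(1)] that(2) j by (meson not_less)
  ultimately have "{j \<in> J. \<forall>i\<in>J. f j \<le> f i} = {j}" using j by blast
  then show "card {j \<in> J. \<forall>i\<in>J. f j \<le> f i} = 1" by simp
next
  assume "card {j \<in> J. \<forall>i\<in>J. f j \<le> f i} = 1"
  then obtain j where "{j \<in> J. \<forall>i\<in>J. f j \<le> f i} = {j}" by (auto simp: card_1_singleton_iff)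
  then have j: "j \<in> J" "\<And>i. i \<in> J \<Longrightarrow> f j \<le> f i"
    and uniq: "\<And>k. k \<in> J \<Longrightarrow> \<forall>i\<in>J. f k \<le> f i \<Longrightarrow> k = j" by blast+
  have "f j < f i" if "i \<in> J - {j}" for i
    using j(2)[of i] uniq[of i] j(2) that by (metis DiffE insertI1 order_le_less)
  then show "J \<in> unique_min_sets n f" using assms j by (auto simp: unique_min_sets_def)
qed

text \<open>When the blocks are the level sets of f in increasing order, the first block meeting J
  cuts out the minimizers of f on J. The list \<open>vs\<close> of level values is left arbitrary so
  that the lemma serves both translations below.\<close>

lemma Orth_iff_unique_min_sets:
  assumes \<pi>: "\<pi> \<in> set_compositions n"
    and vs: "length vs = length \<pi>" "sorted_wrt (<) vs"
    and blocks: "\<And>k. k < length \<pi> \<Longrightarrow> \<pi> ! k = {i \<in> {1..n}. f i = vs ! k}"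
    and J: "J \<in> nonempty_subsets n"
  shows "\<pi> \<in> Orth n J \<longleftrightarrow> J \<in> unique_min_sets n f"
proof -
  have part: "partition_on {1..n} (set \<pi>)" using \<pi> by (simp add: set_compositions_def)
  let ?P = "\<lambda>k. k < length \<pi> \<and> J \<inter> \<pi> ! k \<noteq> {}"
  define k\<^sub>0 where "k\<^sub>0 = (LEAST k. ?P k)"
  have ex: "\<exists>k. ?P k \<and> f i = vs ! k" if "i \<in> J" for i
  proof -
    have "i \<in> \<Union> (set \<pi>)"
      using that J partition_onD1[OF part] by (auto simp: nonempty_subsets_def)
    then obtain k where "k < length \<pi>" "i \<in> \<pi> ! k" by (auto simp: in_set_conv_nth)
    then show ?thesis using that blocks by blast
  qed
  have ge: "vs ! k\<^sub>0 \<le> f i" if "i \<in> J" for i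
  proof -
    from ex[OF that] obtain k where k: "?P k" "f i = vs ! k" by blast
    then have "k\<^sub>0 \<le> k" unfolding k\<^sub>0_def by (intro Least_le)
    then show ?thesis using k vs by (auto simp: sorted_wrt_iff_nth_less le_less)
  qed
  obtain i\<^sub>0 where "i\<^sub>0 \<in> J" using J by (auto simp: nonempty_subsets_def)
  then have k\<^sub>0: "?P k\<^sub>0" using ex unfolding k\<^sub>0_def by (metis (mono_tags, lifting) LeastI)
  have fp: "first_part J \<pi> = {j \<in> J. f j = vs ! k\<^sub>0}"
    using J k\<^sub>0 blocks[of k\<^sub>0] by (auto simp: first_part_def nonempty_subsets_def simp flip: k\<^sub>0_def)
  obtain j\<^sub>0 where j\<^sub>0: "j\<^sub>0 \<in> J" "f j\<^sub>0 = vs ! k\<^sub>0" using k\<^sub>0 blocks[of k\<^sub>0] by auto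
  have "f j = vs ! k\<^sub>0 \<longleftrightarrow> (\<forall>i\<in>J. f j \<le> f i)" if "j \<in> J" for j
    using ge[OF that] ge j\<^sub>0 by (metis order_antisym)
  then have "first_part J \<pi> = {j \<in> J. \<forall>i\<in>J. f j \<le> f i}"
    unfolding fp by blast
  then show ?thesis using \<pi> J by (simp add: Orth_def unique_min_sets_iff_card)
qed

text \<open>This direction turns a covering of all set compositions into a restriction on all
  functions, which puts modular relations into the kernel.\<close>

lemma set_composition_of_function:
  obtains \<pi> where "\<pi> \<in> set_compositions n"
    "\<And>J. J \<in> nonempty_subsets n \<Longrightarrow> \<pi> \<in> Orth n J \<longleftrightarrow> J \<in> unique_min_sets n f"
proof -
  define vs where "vs = sorted_list_of_set (f ` {1..n})"
  define \<pi> where "\<pi> = map (\<lambda>v. {i \<in> {1..n}. f i = v}) vs"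
  have vs: "set vs = f ` {1..n}" "distinct vs" "sorted_wrt (<) vs" by (auto simp: vs_def)
  have "inj_on (\<lambda>v. {i \<in> {1..n}. f i = v}) (set vs)" unfolding vs by (rule inj_onI) blast
  then have "distinct \<pi>" using vs(2) by (simp add: \<pi>_def distinct_map)
  moreover have "partition_on {1..n} (set \<pi>)"
    by (rule partition_onI) (auto simp: \<pi>_def vs(1) disjnt_iff)
  ultimately have "\<pi> \<in> set_compositions n" by (simp add: set_compositions_def)
  then show ?thesis
    using that Orth_iff_unique_min_sets[of \<pi> n vs f] vs(3) by (auto simp: \<pi>_def)
qed

text \<open>The converse direction: if no function has a given family, the covering condition of a
  modular relation follows.\<close>

lemma function_of_set_composition:
  assumes \<pi>: "\<pi> \<in> set_compositions n"
  obtains f where "f \<in> {1..n} \<rightarrow>\<^sub>E {1..}"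
    "\<And>J. J \<in> nonempty_subsets n \<Longrightarrow> \<pi> \<in> Orth n J \<longleftrightarrow> J \<in> unique_min_sets n f"
proof -
  have part: "partition_on {1..n} (set \<pi>)" and dist: "distinct \<pi>"
    using \<pi> by (auto simp: set_compositions_def)
  have "\<forall>i\<in>{1..n}. \<exists>k<length \<pi>. i \<in> \<pi> ! k"
    using partition_onD1[OF part] by (auto simp: in_set_conv_nth)
  then obtain g where g: "\<And>i. i \<in> {1..n} \<Longrightarrow> g i < length \<pi> \<and> i \<in> \<pi> ! g i" by metis
  \<comment> \<open>Blocks are indexed from 0 but values must be positive, hence \<open>Suc\<close>
    and the value list from 1 to \<open>length \<pi>\<close>.\<close>
  define f where "f = (\<lambda>i\<in>{1..n}. Suc (g i))"
  have uniq: "k = l" if "k < length \<pi>" "l < length \<pi>" "i \<in> \<pi> ! k" "i \<in> \<pi> ! l" for i k l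
    using disjointD[OF partition_onD2[OF part], of "\<pi> ! k" "\<pi> ! l"] dist that
    by (auto simp: nth_eq_iff_index_eq)
  have "\<pi> ! k = {i \<in> {1..n}. f i = [1..<Suc (length \<pi>)] ! k}" if k: "k < length \<pi>" for k
  proof -
    have "\<pi> ! k \<subseteq> {1..n}" using partition_onD1[OF part] k by auto
    moreover have "i \<in> \<pi> ! k \<longleftrightarrow> g i = k" if "i \<in> {1..n}" for i
      using g[OF that] uniq[OF _ k, of "g i" i] by auto
    ultimately show ?thesis using k by (auto simp: f_def simp del: upt_Suc)
  qed
  then have "\<pi> \<in> Orth n J \<longleftrightarrow> J \<in> unique_min_sets n f" if "J \<in> nonempty_subsets n" for J
    using Orth_iff_unique_min_sets[OF \<pi>, of "[1..<Suc (length \<pi>)]" f J] that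
    by (simp del: upt_Suc)
  then show ?thesis using that[of f] by (auto simp: f_def)
qed

section \<open>The family under changes of values and of positions\<close>

lemma unique_min_sets_cong:
  assumes "\<And>i. i \<in> {1..n} \<Longrightarrow> f i = g i"
  shows "unique_min_sets n f = unique_min_sets n g"
  using assms by (fastforce simp: unique_min_sets_def nonempty_subsets_def subset_iff)

lemma unique_min_sets_strict_mono:
  assumes "strict_mono_on (f ` {1..n}) \<phi>"
  shows "unique_min_sets n (\<phi> \<circ> f) = unique_min_sets n f"
proof -
  have iff: "\<phi> (f i) < \<phi> (f j) \<longleftrightarrow> f i < f j" if "i \<in> {1..n}" "j \<in> {1..n}" for i j
    using strict_mono_on_less[OF assms] that by auto
  have min: "(\<forall>i\<in>J - {j}. \<phi> (f j) < \<phi> (f i)) \<longleftrightarrow> (\<forall>i\<in>J - {j}. f j < f i)"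
    if "J \<in> nonempty_subsets n" "j \<in> J" for J j
  proof -
    have "J \<subseteq> {1..n}" using that by (simp add: nonempty_subsets_def)
    then show ?thesis using that(2) by (intro ball_cong iff refl) blast+
  qed
  show ?thesis
    unfolding unique_min_sets_def o_apply by (intro Collect_cong conj_cong bex_cong refl min)
qed

lemma unique_min_sets_permute:
  assumes \<sigma>: "\<sigma> permutes {1..n}"
  shows "unique_min_sets n f = (`) \<sigma> ` unique_min_sets n (f \<circ> \<sigma>)"
proof -
  \<comment> \<open>Quantified over the function and the permutation, so that the instance for
    \<open>inv \<sigma>\<close> gives the other inclusion.\<close>
  have img: "\<sigma> ` J \<in> unique_min_sets n f"
    if \<sigma>: "\<sigma> permutes {1..n}" and J: "J \<in> unique_min_sets n (f \<circ> \<sigma>)" for f \<sigma> J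
  proof -
    from J obtain j where j: "J \<subseteq> {1..n}" "j \<in> J" "\<forall>i\<in>J - {j}. f (\<sigma> j) < f (\<sigma> i)"
      by (auto simp: unique_min_sets_def nonempty_subsets_def)
    have "\<sigma> ` J \<subseteq> {1..n}" using image_mono[OF j(1), of \<sigma>] permutes_image[OF \<sigma>] by simp
    moreover have "\<forall>i\<in>\<sigma> ` J - {\<sigma> j}. f (\<sigma> j) < f i" using j(3) by blast
    ultimately show ?thesis using j(2) unfolding unique_min_sets_def nonempty_subsets_def by blast
  qed
  have "J \<in> (`) \<sigma> ` unique_min_sets n (f \<circ> \<sigma>)" if J: "J \<in> unique_min_sets n f" for J
  proof (rule image_eqI)
    have "f \<circ> \<sigma> \<circ> inv \<sigma> = f" using permutes_inv_o(1)[OF \<sigma>] by (simp add: comp_assoc)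
    then show "inv \<sigma> ` J \<in> unique_min_sets n (f \<circ> \<sigma>)"
      using img[OF permutes_inv[OF \<sigma>], of J "f \<circ> \<sigma>"] J by simp
    show "J = \<sigma> ` inv \<sigma> ` J" using permutes_surj[OF \<sigma>] by (simp add: image_f_inv_f)
  qed
  then show ?thesis using img[OF \<sigma>] by blast
qed

section \<open>Shapes of monomials\<close>

text \<open>The monomial that f contributes to the series, that is, the multiset of its
  values.\<close>

definition content :: "nat \<Rightarrow> (nat \<Rightarrow> nat) \<Rightarrow> monomial"
  where "content n f = (\<Sum>i=1..n. Poly_Mapping.single (f i) 1)"

lemma lookup_content: "Poly_Mapping.lookup (content n f) v = card {i \<in> {1..n}. f i = v}"
proof -
  have "Poly_Mapping.lookup (content n f) v = (\<Sum>i\<in>{1..n}. if f i = v then 1 else 0)"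
    by (simp add: content_def lookup_sum lookup_single when_def del: One_nat_def)
  also have "\<dots> = card {i \<in> {1..n}. f i = v}"
    by (simp add: sum.If_cases Int_def)
  finally show ?thesis .
qed

lemma keys_content: "Poly_Mapping.keys (content n f) = f ` {1..n}"
  by (auto simp: in_keys_iff lookup_content)

lemma content_cong: "(\<And>i. i \<in> {1..n} \<Longrightarrow> f i = g i) \<Longrightarrow> content n f = content n g"
  unfolding content_def by (intro sum.cong) auto

text \<open>Equal contents are equal multisets of values, so only the positions of the values can
  differ.\<close>

lemma content_eqE:
  assumes "content n f = content n g"
  obtains \<sigma> where "\<sigma> permutes {1..n}" "\<And>i. i \<in> {1..n} \<Longrightarrow> f i = g (\<sigma> i)"
proof -
  have c: "count (image_mset h (mset_set {1..n})) v = Poly_Mapping.lookup (content n h) v" for h v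
    by (simp add: lookup_content count_image_mset Int_def conj_commute vimage_def)
  have "image_mset f (mset_set {1..n}) = image_mset g (mset_set {1..n})"
    by (rule multiset_eqI) (simp only: c assms)
  then obtain \<sigma> where "\<sigma> permutes {1..n}" "\<forall>i\<in>{1..n}. f i = g (\<sigma> i)"
    using image_mset_eq_implies_permutes[of "{1..n}"] by (metis finite_atLeastAtMost)
  then show ?thesis using that by blast
qed

text \<open>The composition formed by the nonzero exponents in the order of their variables. Index 0
  is treated like any other here, so positivity of the keys is assumed separately where it
  matters.\<close>

definition shape :: "monomial \<Rightarrow> nat list"
  where "shape m = map (Poly_Mapping.lookup m) (sorted_list_of_set (Poly_Mapping.keys m))"

text \<open>An explicit increasing renaming of variables behind an equality of shapes; unlike the
  equality it can be composed with functions.\<close>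

definition relabels :: "(nat \<Rightarrow> nat) \<Rightarrow> monomial \<Rightarrow> monomial \<Rightarrow> bool"
  where "relabels \<phi> m m' \<longleftrightarrow> strict_mono_on (Poly_Mapping.keys m) \<phi> \<and>
    \<phi> ` Poly_Mapping.keys m = Poly_Mapping.keys m' \<and>
    (\<forall>v\<in>Poly_Mapping.keys m. Poly_Mapping.lookup m' (\<phi> v) = Poly_Mapping.lookup m v)"

lemma shape_relabels:
  assumes "relabels \<phi> m m'"
  shows "shape m' = shape m"
proof -
  let ?xs = "sorted_list_of_set (Poly_Mapping.keys m)"
  have \<phi>: "strict_mono_on (Poly_Mapping.keys m) \<phi>" using assms by (simp add: relabels_def)
  have "sorted_wrt (<) (map \<phi> ?xs)"
    unfolding sorted_wrt_map
    by (rule sorted_wrt_mono_rel[of _ "(<)"]) (use strict_mono_onD[OF \<phi>] in auto)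
  then have "sorted_list_of_set (\<phi> ` Poly_Mapping.keys m) = map \<phi> ?xs"
    by (intro strict_sorted_equal) auto
  then show ?thesis using assms by (auto simp: shape_def relabels_def)
qed

lemma shape_eqE:
  assumes eq: "shape m = shape m'"
  obtains \<phi> where "relabels \<phi> m m'"
proof -
  let ?xs = "sorted_list_of_set (Poly_Mapping.keys m)" and ?ys = "sorted_list_of_set (Poly_Mapping.keys m')"
  have len: "length ?xs = length ?ys"
    using eq unfolding shape_def by (metis length_map)
  \<comment> \<open>Sends the k-th smallest key of m to the k-th smallest key of m'; values off the
    keys are irrelevant to \<open>relabels\<close>.\<close>
  define \<phi> where "\<phi> = the \<circ> map_of (zip ?xs ?ys)"
  have \<phi>: "\<phi> (?xs ! k) = ?ys ! k" if "k < length ?xs" for k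
    using map_of_zip_nth[OF len, of k] that len by (simp add: \<phi>_def)
  then have map: "map \<phi> ?xs = ?ys" using len by (intro nth_equalityI) auto
  have "strict_mono_on (Poly_Mapping.keys m) \<phi>"
  proof (rule strict_mono_onI)
    fix v w assume "v \<in> Poly_Mapping.keys m" "w \<in> Poly_Mapping.keys m" "v < w"
    then obtain k l where kl: "k < length ?xs" "v = ?xs ! k" "l < length ?xs" "w = ?xs ! l"
      by (metis finite_keys in_set_conv_nth set_sorted_list_of_set)
    have "k < l"
    proof (rule ccontr)
      assume "\<not> k < l"
      then have "?xs ! l \<le> ?xs ! k" using kl by (intro sorted_nth_mono) auto
      then show False using \<open>v < w\<close> kl by simp
    qed
    then have "?ys ! k < ?ys ! l"
      using kl len strict_sorted_list_of_set[of "Poly_Mapping.keys m'"] by (auto simp: sorted_wrt_iff_nth_less)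
    then show "\<phi> v < \<phi> w" using \<phi> kl by simp
  qed
  moreover have "\<phi> ` Poly_Mapping.keys m = Poly_Mapping.keys m'"
    using arg_cong[OF map, of set] by simp
  moreover have "map (Poly_Mapping.lookup m') (map \<phi> ?xs) = map (Poly_Mapping.lookup m) ?xs"
    unfolding map using eq by (simp add: shape_def)
  then have "\<forall>v\<in>Poly_Mapping.keys m. Poly_Mapping.lookup m' (\<phi> v) = Poly_Mapping.lookup m v"
    by simp
  ultimately show ?thesis using that by (auto simp: relabels_def)
qed

lemma content_relabel:
  assumes "inj_on \<phi> (f ` {1..n})" "v \<in> f ` {1..n}"
  shows "Poly_Mapping.lookup (content n (\<phi> \<circ> f)) (\<phi> v) = Poly_Mapping.lookup (content n f) v"
proof -
  have "\<phi> (f i) = \<phi> v \<longleftrightarrow> f i = v" if "i \<in> {1..n}" for i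
    using assms that by (auto dest: inj_onD)
  then show ?thesis unfolding lookup_content by (intro arg_cong[where f = card]) auto
qed

lemma relabels_content:
  assumes "strict_mono_on (f ` {1..n}) \<phi>"
  shows "relabels \<phi> (content n f) (content n (\<phi> \<circ> f))"
  using assms content_relabel[OF strict_mono_on_imp_inj_on[OF assms]]
  by (simp add: relabels_def keys_content image_comp)

lemma content_comp_relabels:
  assumes "relabels \<phi> (content n f) m"
  shows "content n (\<phi> \<circ> f) = m"
proof (rule poly_mapping_eqI)
  fix w
  have \<phi>: "strict_mono_on (f ` {1..n}) \<phi>" and keys: "\<phi> ` f ` {1..n} = Poly_Mapping.keys m"
    using assms by (auto simp: relabels_def keys_content)
  show "Poly_Mapping.lookup (content n (\<phi> \<circ> f)) w = Poly_Mapping.lookup m w"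
  proof (cases "w \<in> Poly_Mapping.keys m")
    case True
    then obtain v where "v \<in> f ` {1..n}" "w = \<phi> v" using keys by blast
    then show ?thesis
      using assms content_relabel[OF strict_mono_on_imp_inj_on[OF \<phi>]]
      by (auto simp: relabels_def keys_content)
  next
    case False
    then have "w \<notin> Poly_Mapping.keys (content n (\<phi> \<circ> f))"
      using keys by (auto simp: keys_content)
    then show ?thesis using False by (simp add: in_keys_iff)
  qed
qed

text \<open>An increasing relabelling of the values of f makes the contents equal without touching
  the family; equal contents then differ by a permutation of positions.\<close>

lemma shape_eq_imp_permuted:
  assumes "shape (content n f) = shape (content n g)"
  obtains \<sigma> where "\<sigma> permutes {1..n}" "unique_min_sets n g = (`) \<sigma> ` unique_min_sets n f"
proof -
  obtain \<phi> where \<phi>: "relabels \<phi> (content n f) (content n g)" using shape_eqE[OF assms] .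
  obtain \<sigma> where \<sigma>: "\<sigma> permutes {1..n}" "\<And>i. i \<in> {1..n} \<Longrightarrow> (\<phi> \<circ> f) i = g (\<sigma> i)"
    using content_eqE[OF content_comp_relabels[OF \<phi>]] by metis
  have "unique_min_sets n f = unique_min_sets n (\<phi> \<circ> f)"
    using \<phi> by (intro unique_min_sets_strict_mono[symmetric]) (simp add: relabels_def keys_content)
  also have "\<dots> = unique_min_sets n (g \<circ> \<sigma>)"
    using \<sigma>(2) by (intro unique_min_sets_cong) auto
  finally show ?thesis using that \<sigma>(1) unique_min_sets_permute[OF \<sigma>(1), of g] by metis
qed

text \<open>If [n] is listed level by level, level v occupies an interval of positions starting at
  \<open>below n f v\<close>, counted from 0. Replacing each value by the start of its level gives a
  normal form that depends only on the level sizes in order.\<close>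

definition below :: "nat \<Rightarrow> (nat \<Rightarrow> nat) \<Rightarrow> nat \<Rightarrow> nat"
  where "below n f v = card {j \<in> {1..n}. f j < v}"

text \<open>Read in terms of positions: the intervals of distinct levels do not overlap.\<close>

lemma below_add_level_le:
  assumes "v < w"
  shows "below n f v + card {j \<in> {1..n}. f j = v} \<le> below n f w"
proof -
  have "below n f v + card {j \<in> {1..n}. f j = v} = card ({j \<in> {1..n}. f j < v} \<union> {j \<in> {1..n}. f j = v})"
    unfolding below_def by (intro card_Un_disjoint[symmetric]) auto
  also have "\<dots> \<le> below n f w"
    unfolding below_def using assms by (intro card_mono) auto
  finally show ?thesis .
qed

lemma level_pos: "i \<in> {1..n::nat} \<Longrightarrow> 0 < card {j \<in> {1..n}. f j = f i}"
  by (auto simp: card_gt_0_iff)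

lemma strict_mono_on_below: "strict_mono_on (f ` {1..n}) (below n f)"
proof (rule strict_mono_onI)
  fix v w assume "v \<in> f ` {1..n}" "v < w"
  then show "below n f v < below n f w"
    using below_add_level_le[of v w n f] level_pos[of _ n f] by fastforce
qed

text \<open>The level intervals leave no gap. The last level starting at or before p contains p,
  because the next level begins exactly where it ends, and the top level ends at n.\<close>

lemma below_cover:
  assumes "p < n"
  obtains i where "i \<in> {1..n}" "below n f (f i) \<le> p" "p < below n f (f i) + card {j \<in> {1..n}. f j = f i}"
proof -
  let ?V = "{v \<in> f ` {1..n}. below n f v \<le> p}"
  have ne: "f ` {1..n} \<noteq> {}" using assms by auto
  have "\<not> f j < Min (f ` {1..n})" if "j \<in> {1..n}" for j
    using Min_le[of "f ` {1..n}" "f j"] that by force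
  then have "{j \<in> {1..n}. f j < Min (f ` {1..n})} = {}" by blast
  then have "below n f (Min (f ` {1..n})) = 0" unfolding below_def by simp
  then have "Min (f ` {1..n}) \<in> ?V" using ne Min_in[OF _ ne] by simp
  then have "Max ?V \<in> ?V" by (intro Max_in) auto
  then obtain i where i: "i \<in> {1..n}" "below n f (f i) \<le> p" "f i = Max ?V" by auto
  have "p < below n f (f i) + card {j \<in> {1..n}. f j = f i}"
  proof (cases "\<exists>j\<in>{1..n}. f i < f j")
    case True
    \<comment> \<open>The least element of \<open>?W\<close> is the next value of f; by maximality
      of f i in \<open>?V\<close> its level starts after p.\<close>
    let ?W = "{v \<in> f ` {1..n}. f i < v}"
    have "?W \<noteq> {}" using True by auto
    then have "Min ?W \<in> ?W" by (intro Min_in) auto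
    then have w: "Min ?W \<in> f ` {1..n}" "f i < Min ?W" by auto
    have "Min ?W \<notin> ?V"
    proof
      assume "Min ?W \<in> ?V"
      then have "Min ?W \<le> Max ?V" by (intro Max_ge) auto
      then show False using w(2) i(3) by linarith
    qed
    then have "p < below n f (Min ?W)"
      using w(1) by (simp only: mem_Collect_eq not_le) simp
    have "f j < Min ?W \<longleftrightarrow> f j < f i \<or> f j = f i" if "j \<in> {1..n}" for j
    proof (cases "f i < f j")
      case True
      then have "Min ?W \<le> f j" using that by (intro Min_le) auto
      then show ?thesis using True by linarith
    qed (use w(2) in linarith)
    then have "{j \<in> {1..n}. f j < Min ?W} = {j \<in> {1..n}. f j < f i} \<union> {j \<in> {1..n}. f j = f i}"
      by blast
    then have "below n f (Min ?W) = card ({j \<in> {1..n}. f j < f i} \<union> {j \<in> {1..n}. f j = f i})"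
      by (simp only: below_def)
    also have "\<dots> = below n f (f i) + card {j \<in> {1..n}. f j = f i}"
      unfolding below_def by (intro card_Un_disjoint) auto
    finally show ?thesis using \<open>p < below n f (Min ?W)\<close> by simp
  next
    case False
    then have "{1..n} = {j \<in> {1..n}. f j < f i} \<union> {j \<in> {1..n}. f j = f i}" by force
    then have "n = card ({j \<in> {1..n}. f j < f i} \<union> {j \<in> {1..n}. f j = f i})" by (metis card_atLeastAtMost diff_Suc_1)
    also have "\<dots> = below n f (f i) + card {j \<in> {1..n}. f j = f i}"
      unfolding below_def by (intro card_Un_disjoint) auto
    finally show ?thesis using assms by simp
  qed
  then show ?thesis using that i by blast
qed

lemma pair_in_unique_min_sets:
  "i \<in> {1..n} \<Longrightarrow> j \<in> {1..n} \<Longrightarrow> i \<noteq> j \<Longrightarrow> {i, j} \<in> unique_min_sets n f \<longleftrightarrow> f i \<noteq> f j"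
  by (auto simp: unique_min_sets_def nonempty_subsets_def neq_iff)

text \<open>The tied elements j and k serve as a probe: i produces a unique minimum exactly by
  undercutting the tie. The probe exists for every level with at least two elements.\<close>

lemma triple_in_unique_min_sets:
  assumes "i \<in> {1..n}" "j \<in> {1..n}" "k \<in> {1..n}" "j \<noteq> k" "f j = f k"
  shows "{i, j, k} \<in> unique_min_sets n f \<longleftrightarrow> f i < f j"
proof
  assume "{i, j, k} \<in> unique_min_sets n f"
  then obtain a where a: "a \<in> {i, j, k}" "\<And>b. b \<in> {i, j, k} \<Longrightarrow> b \<noteq> a \<Longrightarrow> f a < f b"
    unfolding unique_min_sets_def by blast
  have "a \<noteq> j" "a \<noteq> k" using a(2)[of j] a(2)[of k] assms by auto
  then show "f i < f j" using a(1) a(2)[of j] by auto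
next
  assume "f i < f j"
  then show "{i, j, k} \<in> unique_min_sets n f"
    using assms by (auto simp: unique_min_sets_def nonempty_subsets_def)
qed

text \<open>
  The family does not determine the order of adjacent singleton levels, but it determines the
  position of every larger level, and the singletons fill the remaining positions.
\<close>

lemma unique_min_sets_determine_levels:
  assumes eq: "unique_min_sets n f = unique_min_sets n g" and i: "i \<in> {1..n}"
  obtains j where "j \<in> {1..n}" "below n g (g j) = below n f (f i)"
    "card {k \<in> {1..n}. g k = g j} = card {k \<in> {1..n}. f k = f i}"
proof -
  have same: "f k = f j \<longleftrightarrow> g k = g j" if "j \<in> {1..n}" "k \<in> {1..n}" for j k
    using pair_in_unique_min_sets[of j n k] that eq by (cases "j = k") metis+
  then have lev: "card {k \<in> {1..n}. f k = f j} = card {k \<in> {1..n}. g k = g j}" if "j \<in> {1..n}" for j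
    using that by (intro arg_cong[where f = card]) auto
  \<comment> \<open>A second element of the level provides the probe, which shows that f and g place
    the same elements below it.\<close>
  have big: "below n f (f j) = below n g (g j)"
    if j: "j \<in> {1..n}" "card {k \<in> {1..n}. f k = f j} \<noteq> 1" for j
  proof -
    have "\<exists>k\<in>{1..n}. k \<noteq> j \<and> f j = f k"
    proof (rule ccontr)
      assume "\<not> ?thesis"
      then have "{k \<in> {1..n}. f k = f j} = {j}" using j(1) by auto
      then show False using j(2) by simp
    qed
    then obtain k where k: "k \<in> {1..n}" "k \<noteq> j" "f j = f k" by auto
    then have "f i < f j \<longleftrightarrow> g i < g j" if "i \<in> {1..n}" for i
      using triple_in_unique_min_sets[of i n j k] same[of j k] j(1) that eq by metis
    then show ?thesis unfolding below_def by (intro arg_cong[where f = card]) auto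
  qed
  show ?thesis
  proof (cases "card {k \<in> {1..n}. f k = f i} = 1")
    case False
    then show ?thesis using that[of i] i big lev by metis
  next
    case True
    have "{j \<in> {1..n}. f j < f i} \<subset> {1..n}" using i by blast
    then have "below n f (f i) < n"
      using psubset_card_mono[of "{1..n}"] by (simp add: below_def)
    \<comment> \<open>For a singleton level of f the witness is the level of g covering its
      position; it need not contain i itself.\<close>
    then obtain j where j: "j \<in> {1..n}" "below n g (g j) \<le> below n f (f i)"
        "below n f (f i) < below n g (g j) + card {k \<in> {1..n}. g k = g j}"
      using below_cover[of "below n f (f i)" n g] by auto
    \<comment> \<open>A larger level would occupy the same interval for f by \<open>big\<close> and
      \<open>lev\<close>, and so overlap the singleton level of i. For a singleton level, covering
      the position means starting there.\<close>
    have "card {k \<in> {1..n}. g k = g j} = 1"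
    proof (rule ccontr)
      assume "card {k \<in> {1..n}. g k = g j} \<noteq> 1"
      then have *: "card {k \<in> {1..n}. f k = f j} \<noteq> 1" using lev j(1) by simp
      then have "f i \<noteq> f j" using True by auto
      then show False
        using below_add_level_le[of "f i" "f j" n f] below_add_level_le[of "f j" "f i" n f]
          j big[OF j(1) *] lev[OF j(1)] True by (auto simp: neq_iff)
    qed
    then show ?thesis using that[of j] j True by auto
  qed
qed

text \<open>Starts and sizes of the levels are recorded by the content of
  \<open>below n f \<circ> f\<close>, whose shape is that of \<open>content n f\<close> because
  \<open>below n f\<close> is strictly increasing on the values.\<close>

lemma unique_min_sets_determine_shape:
  assumes eq: "unique_min_sets n f = unique_min_sets n g"
  shows "shape (content n f) = shape (content n g)"
proof -
  have level: "Poly_Mapping.lookup (content n (below n h \<circ> h)) (below n h (h i)) = card {k \<in> {1..n}. h k = h i}"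
    if "i \<in> {1..n}" for h i
    using content_relabel[OF strict_mono_on_imp_inj_on[OF strict_mono_on_below]] that
    by (auto simp: lookup_content)
  \<comment> \<open>Covers the keys of the first content; exchanging f and g covers those of the
    second, and elsewhere both exponents are 0.\<close>
  have le: "Poly_Mapping.lookup (content n (below n f \<circ> f)) p = Poly_Mapping.lookup (content n (below n g \<circ> g)) p"
    if eq: "unique_min_sets n f = unique_min_sets n g"
      and p: "p \<in> Poly_Mapping.keys (content n (below n f \<circ> f))" for p f g
  proof -
    obtain i where i: "i \<in> {1..n}" "p = below n f (f i)" using p by (auto simp: keys_content)
    then show ?thesis
      using unique_min_sets_determine_levels[OF eq i(1)] level[of _ f] level[of _ g] by metis
  qed
  have "content n (below n f \<circ> f) = content n (below n g \<circ> g)"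
    using le[OF eq] le[OF eq[symmetric]] by (intro poly_mapping_eqI) (metis in_keys_iff)
  then show ?thesis
    using shape_relabels[OF relabels_content[OF strict_mono_on_below]] by metis
qed

section \<open>Quasisymmetric functions\<close>

lemma
  assumes len: "length is = length as" and "0 \<notin> set as" and sorted: "sorted_wrt (<) is"
  shows keys_monomial_of: "Poly_Mapping.keys (monomial_of is as) = set is"
    and shape_monomial_of: "shape (monomial_of is as) = as"
proof -
  let ?L = "Poly_Mapping.lookup (monomial_of is as)"
  have dist: "distinct is" using sorted by (simp add: strict_sorted_iff)
  have L: "?L v = (\<Sum>l<length is. as ! l when is ! l = v)" for v
    by (simp add: monomial_of_def lookup_sum lookup_single)
  have at: "?L (is ! k) = as ! k" if "k < length is" for k
  proof -
    have "?L (is ! k) = (\<Sum>l<length is. as ! l when l = k)"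
      unfolding L using that dist
      by (intro sum.cong) (auto simp: nth_eq_iff_index_eq when_def)
    then show ?thesis using that by (simp add: when_def if_distrib cong: if_cong)
  qed
  have "?L v = 0" if "v \<notin> set is" for v
    unfolding L using that by (intro sum.neutral) (auto simp: when_def)
  moreover have "?L v \<noteq> 0" if v: "v \<in> set is" for v
  proof -
    from v obtain k where "k < length is" "v = is ! k" by (auto simp: in_set_conv_nth)
    then show ?thesis using at[of k] assms(2) len by (metis nth_mem)
  qed
  ultimately show keys: "Poly_Mapping.keys (monomial_of is as) = set is"
    by (auto simp: in_keys_iff)
  have "sorted_list_of_set (set is) = is" using sorted by (intro strict_sorted_equal) auto
  then show "shape (monomial_of is as) = as"
    unfolding shape_def keys using at len by (intro nth_equalityI) auto
qed

lemma monomial_of_shape: "monomial_of (sorted_list_of_set (Poly_Mapping.keys m)) (shape m) = m"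
proof -
  let ?xs = "sorted_list_of_set (Poly_Mapping.keys m)"
  have "monomial_of ?xs (shape m) = (\<Sum>l<length ?xs. Poly_Mapping.single (?xs ! l) (Poly_Mapping.lookup m (?xs ! l)))"
    unfolding monomial_of_def shape_def by (intro sum.cong) auto
  also have "\<dots> = (\<Sum>v\<leftarrow>?xs. Poly_Mapping.single v (Poly_Mapping.lookup m v))"
    by (simp add: sum_list_sum_nth atLeast0LessThan)
  also have "\<dots> = (\<Sum>v\<in>Poly_Mapping.keys m. Poly_Mapping.single v (Poly_Mapping.lookup m v))"
    by (simp add: sum_list_distinct_conv_sum_set)
  also have "\<dots> = m"
    by (rule poly_mapping_eqI) (auto simp: lookup_sum lookup_single when_def in_keys_iff)
  finally show ?thesis .
qed

lemma zero_notin_shape: "0 \<notin> set (shape m)"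
  by (auto simp: shape_def in_keys_iff)

lemma sum_list_shape: "sum_list (shape m) = (\<Sum>i\<in>Poly_Mapping.keys m. Poly_Mapping.lookup m i)"
  by (simp add: shape_def sum_list_distinct_conv_sum_set)

text \<open>The lists \<open>is\<close> and \<open>as\<close> are just the sorted keys and the shape
  of a monomial, so quasisymmetry is invariance under equality of shapes.\<close>

lemma QSym_iff_shape:
  "F \<in> QSym \<longleftrightarrow> (\<forall>m. 0 \<in> Poly_Mapping.keys m \<longrightarrow> F m = 0) \<and>
     (\<exists>d. \<forall>m. F m \<noteq> 0 \<longrightarrow> sum_list (shape m) \<le> d) \<and>
     (\<forall>m m'. 0 \<notin> Poly_Mapping.keys m \<and> 0 \<notin> Poly_Mapping.keys m' \<and> shape m = shape m' \<longrightarrow> F m = F m')"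
proof -
  have "(\<forall>is js as. length is = length as \<and> length js = length as \<and> 0 \<notin> set as \<and>
        0 \<notin> set is \<and> 0 \<notin> set js \<and> sorted_wrt (<) is \<and> sorted_wrt (<) js
        \<longrightarrow> F (monomial_of is as) = F (monomial_of js as))
    \<longleftrightarrow> (\<forall>m m'. 0 \<notin> Poly_Mapping.keys m \<and> 0 \<notin> Poly_Mapping.keys m' \<and> shape m = shape m' \<longrightarrow> F m = F m')"
    (is "?Q \<longleftrightarrow> ?S")
  proof
    assume Q: ?Q
    show ?S
    proof (intro allI impI)
      fix m m' assume m: "0 \<notin> Poly_Mapping.keys m \<and> 0 \<notin> Poly_Mapping.keys m' \<and> shape m = shape m'"
      let ?is = "sorted_list_of_set (Poly_Mapping.keys m)" and ?js = "sorted_list_of_set (Poly_Mapping.keys m')"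
      have "length ?is = length (shape m)" "length ?js = length (shape m')"
        unfolding shape_def by (simp_all only: length_map)
      then have "F (monomial_of ?is (shape m)) = F (monomial_of ?js (shape m))"
        using Q m zero_notin_shape[of m] by auto
      then show "F m = F m'" using m monomial_of_shape by metis
    qed
  next
    assume ?S
    then show ?Q using keys_monomial_of shape_monomial_of by metis
  qed
  then show ?thesis unfolding QSym_def sum_list_shape by simp
qed

lemma subspace_QSym: "series.subspace (QSym :: 'k::field_char_0 series set)"
  unfolding series.subspace_def
proof (intro conjI ballI allI)
  show "(0 :: 'k series) \<in> QSym" by (simp add: QSym_iff_shape)
next
  fix F G :: "'k series" assume FG: "F \<in> QSym" "G \<in> QSym"
  then obtain d e where "\<And>m. F m \<noteq> 0 \<Longrightarrow> sum_list (shape m) \<le> d" "\<And>m. G m \<noteq> 0 \<Longrightarrow> sum_list (shape m) \<le> e"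
    by (auto simp: QSym_iff_shape)
  then have "\<forall>m. (F + G) m \<noteq> 0 \<longrightarrow> sum_list (shape m) \<le> max d e"
    by (metis add_0 le_max_iff_disj plus_fun_apply)
  then show "F + G \<in> QSym" using FG unfolding QSym_iff_shape plus_fun_apply by (metis add_0)
next
  fix c and F :: "'k series" assume "F \<in> QSym"
  moreover from this obtain d where "\<And>m. F m \<noteq> 0 \<Longrightarrow> sum_list (shape m) \<le> d"
    by (auto simp: QSym_iff_shape)
  then have "\<forall>m. series_scale c F m \<noteq> 0 \<longrightarrow> sum_list (shape m) \<le> d"
    by (simp add: series_scale_def)
  ultimately show "series_scale c F \<in> QSym"
    unfolding QSym_iff_shape by (auto simp: series_scale_def)
qed

text \<open>Consequently a shape determines the ambient dimension of every function realizing
  it.\<close>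

lemma sum_list_shape_content: "sum_list (shape (content n f)) = n"
  using sum.image_gen[of "{1..n}" "\<lambda>_. 1 :: nat" f]
  by (simp add: sum_list_shape keys_content lookup_content)

section \<open>Series of hypergraphic polytopes and expansion of quasisymmetric functions\<close>

lemma generic_with_hypergraphic:
  assumes "hypergraphic n q"
  shows "generic_with n q m =
    {f \<in> {1..n} \<rightarrow>\<^sub>E {1..}. content n f = m \<and> hgp_family n q \<subseteq> unique_min_sets n f}"
  unfolding generic_with_def generic_hypergraphic[OF assms] content_def by blast

text \<open>Composition with an increasing relabelling is injective and keeps the family; positivity
  of the keys of m' keeps the values in range. Equality follows by exchanging m and m'.\<close>

lemma card_generic_with_le:
  assumes q: "hypergraphic n q" and shape: "shape m = shape m'" and pos: "0 \<notin> Poly_Mapping.keys m'"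
  shows "card (generic_with n q m) \<le> card (generic_with n q m')"
proof -
  obtain \<phi> where \<phi>: "relabels \<phi> m m'" using shape_eqE[OF shape] .
  then have mono: "strict_mono_on (Poly_Mapping.keys m) \<phi>" by (simp add: relabels_def)
  have keys: "f ` {1..n} = Poly_Mapping.keys m" if "f \<in> generic_with n q m" for f
    using that unfolding generic_with_hypergraphic[OF q] keys_content[symmetric] by simp
  show ?thesis
  proof (rule card_inj_on_le[OF _ _ finite_generic_with])
    show "inj_on (\<lambda>f. restrict (\<phi> \<circ> f) {1..n}) (generic_with n q m)"
    proof (rule inj_onI)
      fix f g assume fg: "f \<in> generic_with n q m" "g \<in> generic_with n q m"
        and eq: "restrict (\<phi> \<circ> f) {1..n} = restrict (\<phi> \<circ> g) {1..n}"
      have "f i = g i" if i: "i \<in> {1..n}" for i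
      proof (rule inj_onD[OF strict_mono_on_imp_inj_on[OF mono]])
        show "\<phi> (f i) = \<phi> (g i)" using fun_cong[OF eq, of i] i by simp
        show "f i \<in> Poly_Mapping.keys m" "g i \<in> Poly_Mapping.keys m" using i keys fg by blast+
      qed
      then show "f = g" using fg by (intro PiE_ext[of f "{1..n}" "\<lambda>_. {1..}"]) (auto simp: generic_with_def)
    qed
    show "(\<lambda>f. restrict (\<phi> \<circ> f) {1..n}) ` generic_with n q m \<subseteq> generic_with n q m'"
    proof (rule image_subsetI)
      fix f assume f: "f \<in> generic_with n q m"
      let ?g = "restrict (\<phi> \<circ> f) {1..n}"
      have c: "content n f = m" using f unfolding generic_with_hypergraphic[OF q] by simp
      have "content n ?g = content n (\<phi> \<circ> f)" by (intro content_cong) simp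
      then have cg: "content n ?g = m'" using content_comp_relabels \<phi> c by simp
      have "unique_min_sets n ?g = unique_min_sets n (\<phi> \<circ> f)" by (intro unique_min_sets_cong) simp
      also have "\<dots> = unique_min_sets n f"
        using unique_min_sets_strict_mono mono keys[OF f] by simp
      finally have U: "unique_min_sets n ?g = unique_min_sets n f" .
      have "?g i \<in> {1..}" if i: "i \<in> {1..n}" for i
      proof -
        have "?g i \<in> Poly_Mapping.keys m'" unfolding cg[symmetric] keys_content using i by blast
        then show ?thesis using pos by (cases "?g i = 0") auto
      qed
      then have "?g \<in> {1..n} \<rightarrow>\<^sub>E {1..}" by (intro PiE_I) auto
      then show "?g \<in> generic_with n q m'"
        using f cg U unfolding generic_with_hypergraphic[OF q] by auto
    qed
  qed
qed

lemma Psi_polytope_in_QSym: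
  assumes q: "hypergraphic n q"
  shows "(Psi_polytope n q :: 'k::field_char_0 series) \<in> QSym"
proof -
  have c: "content n f = m" "f ` {1..n} \<subseteq> {1..}" if "f \<in> generic_with n q m" for f m
    using that unfolding generic_with_hypergraphic[OF q] by auto
  have ne: "\<exists>f. f \<in> generic_with n q m" if "(Psi_polytope n q :: 'k series) m \<noteq> 0" for m
    using that by (cases "generic_with n q m = {}") (auto simp: Psi_polytope_def)
  have "(Psi_polytope n q :: 'k series) m = 0" if "0 \<in> Poly_Mapping.keys m" for m
  proof (rule ccontr)
    assume "(Psi_polytope n q :: 'k series) m \<noteq> 0"
    then obtain f where "f \<in> generic_with n q m" using ne by blast
    then have "Poly_Mapping.keys m \<subseteq> {1..}" using c keys_content by metis
    then show False using that by auto
  qed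
  moreover have "sum_list (shape m) \<le> n" if "(Psi_polytope n q :: 'k series) m \<noteq> 0" for m
    using ne[OF that] c(1) sum_list_shape_content by fastforce
  moreover have "(Psi_polytope n q :: 'k series) m = Psi_polytope n q m'"
    if "0 \<notin> Poly_Mapping.keys m" "0 \<notin> Poly_Mapping.keys m'" "shape m = shape m'" for m m'
    using card_generic_with_le[OF q that(3,2)] card_generic_with_le[OF q that(3)[symmetric] that(1)]
    by (simp add: Psi_polytope_def)
  ultimately show ?thesis unfolding QSym_iff_shape by blast
qed

lemma content_surj:
  assumes "0 \<notin> Poly_Mapping.keys m"
  obtains n f where "f \<in> {1..n} \<rightarrow>\<^sub>E {1..}" "content n f = m"
proof -
  obtain xs where "mset xs = Abs_multiset (Poly_Mapping.lookup m)" using ex_mset by blast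
  moreover have "finite {v. 0 < Poly_Mapping.lookup m v}"
    using finite_keys[of m] by (simp add: keys.rep_eq)
  ultimately have xs: "count (mset xs) = Poly_Mapping.lookup m" by (simp add: count_Abs_multiset)
  \<comment> \<open>The monomial is listed as a multiset; list entries are numbered from 0 and
    positions from 1.\<close>
  define f where "f = (\<lambda>i\<in>{1..length xs}. xs ! (i - 1))"
  have "Poly_Mapping.lookup (content (length xs) f) v = Poly_Mapping.lookup m v" for v
  proof -
    have "{i \<in> {1..length xs}. f i = v} = Suc ` {i. i < length xs \<and> v = xs ! i}"
    proof (intro equalityI subsetI)
      fix i assume "i \<in> {i \<in> {1..length xs}. f i = v}"
      then show "i \<in> Suc ` {i. i < length xs \<and> v = xs ! i}"
        by (intro image_eqI[of _ _ "i - 1"]) (auto simp: f_def)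
    qed (auto simp: f_def)
    then have "Poly_Mapping.lookup (content (length xs) f) v = card {i. i < length xs \<and> v = xs ! i}"
      unfolding lookup_content by (simp add: card_image)
    also have "\<dots> = count (mset xs) v" unfolding count_mset count_list_eq_length_filter length_filter_conv_card ..
    finally show ?thesis unfolding xs .
  qed
  then have c: "content (length xs) f = m" by (rule poly_mapping_eqI)
  then have "f ` {1..length xs} = Poly_Mapping.keys m" using keys_content by metis
  then have "f i \<noteq> 0" if "i \<in> {1..length xs}" for i using that assms by (metis image_eqI)
  then have "f \<in> {1..length xs} \<rightarrow>\<^sub>E {1..}" by (auto simp: f_def Suc_le_eq)
  then show ?thesis using that c by blast
qed

lemma shape_content_surj:
  assumes "0 \<notin> set \<alpha>"
  obtains n f where "f \<in> {1..n} \<rightarrow>\<^sub>E {1..}" "shape (content n f) = \<alpha>"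
proof -
  let ?m = "monomial_of [1..<Suc (length \<alpha>)] \<alpha>"
  have "0 \<notin> Poly_Mapping.keys ?m" "shape ?m = \<alpha>"
    using keys_monomial_of[of "[1..<Suc (length \<alpha>)]" \<alpha>] shape_monomial_of[of "[1..<Suc (length \<alpha>)]" \<alpha>] assms
    by (simp_all del: upt_Suc)
  then show ?thesis using that content_surj by metis
qed

lemma sum_fun_apply: "(\<Sum>a\<in>A. F a) x = (\<Sum>a\<in>A. F a x)"
  by (induction A rule: infinite_finite_induct) auto

definition monomial_qsym :: "nat list \<Rightarrow> 'k::field_char_0 series"
  where "monomial_qsym \<alpha> = (\<lambda>m. if 0 \<notin> Poly_Mapping.keys m \<and> shape m = \<alpha> then 1 else 0)"

text \<open>Bounded degree leaves finitely many compositions, since positive parts bound the length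
  by the sum. The coefficient of each is read off at the monomial in the first variables.\<close>

lemma QSym_expand:
  assumes F: "(F :: 'k::field_char_0 series) \<in> QSym"
  obtains K c where "finite K" "\<And>\<alpha>. \<alpha> \<in> K \<Longrightarrow> 0 \<notin> set \<alpha>" "F = (\<Sum>\<alpha>\<in>K. series_scale (c \<alpha>) (monomial_qsym \<alpha>))"
proof -
  obtain d where d: "\<And>m. F m \<noteq> 0 \<Longrightarrow> sum_list (shape m) \<le> d" using F by (auto simp: QSym_iff_shape)
  define K where "K = {\<alpha>. 0 \<notin> set \<alpha> \<and> sum_list \<alpha> \<le> d}"
  define c where "c \<alpha> = F (monomial_of [1..<Suc (length \<alpha>)] \<alpha>)" for \<alpha>
  have "length \<alpha> \<le> sum_list \<alpha>" if "0 \<notin> set \<alpha>" for \<alpha> :: "nat list"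
    using that by (induction \<alpha>) auto
  then have "K \<subseteq> {\<alpha>. set \<alpha> \<subseteq> {..d} \<and> length \<alpha> \<le> d}"
    using member_le_sum_list by (fastforce simp: K_def)
  then have fin: "finite K" using finite_lists_length_le[of "{..d}" d] finite_subset by auto
  have F_eq: "F m = (\<Sum>\<alpha>\<in>K. series_scale (c \<alpha>) (monomial_qsym \<alpha>)) m" for m
  proof (cases "0 \<in> Poly_Mapping.keys m")
    case True
    then show ?thesis
      using F by (simp add: QSym_iff_shape sum_fun_apply series_scale_def monomial_qsym_def)
  next
    case False
    let ?m = "monomial_of [1..<Suc (length (shape m))] (shape m)"
    have m: "Poly_Mapping.keys ?m = set [1..<Suc (length (shape m))]" "shape ?m = shape m"
      using zero_notin_shape[of m] by (intro keys_monomial_of shape_monomial_of; simp del: upt_Suc)+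
    then have "0 \<notin> Poly_Mapping.keys ?m" by (simp del: upt_Suc)
    then have Fm: "F m = c (shape m)"
      using F False m(2) unfolding QSym_iff_shape c_def by metis
    have "(\<Sum>\<alpha>\<in>K. series_scale (c \<alpha>) (monomial_qsym \<alpha>)) m = (\<Sum>\<alpha>\<in>K. if shape m = \<alpha> then c \<alpha> else 0)"
      using False by (simp add: sum_fun_apply series_scale_def monomial_qsym_def if_distrib cong: if_cong)
    also have "\<dots> = (if shape m \<in> K then c (shape m) else 0)" using fin by simp
    also have "\<dots> = F m" using Fm d[of m] zero_notin_shape[of m] by (auto simp: K_def)
    finally show ?thesis ..
  qed
  show ?thesis
  proof (rule that[OF fin])
    show "F = (\<Sum>\<alpha>\<in>K. series_scale (c \<alpha>) (monomial_qsym \<alpha>))" using F_eq by (rule ext)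
  qed (simp add: K_def)
qed

section \<open>The kernel and the image\<close>

interpretation Psi: Vector_Spaces.linear hgp_scale series_scale "Psi :: 'k::field_char_0 hgp_comb \<Rightarrow> _"
  by (rule linear_Psi)

lemma single_eq_hgp_scale: "Poly_Mapping.single b c = hgp_scale c (Poly_Mapping.single b 1)"
  by (rule poly_mapping_eqI) (simp add: lookup_hgp_scale lookup_single when_def)

lemma subspace_HGP: "hgp.subspace (HGP :: 'k::field_char_0 hgp_comb set)"
  unfolding hgp.subspace_def HGP_def
proof (intro conjI ballI allI)
  fix v w :: "'k hgp_comb"
  assume "v \<in> {v. Poly_Mapping.keys v \<subseteq> {(n, q). hypergraphic n q}}" "w \<in> {v. Poly_Mapping.keys v \<subseteq> {(n, q). hypergraphic n q}}"
  then show "v + w \<in> {v. Poly_Mapping.keys v \<subseteq> {(n, q). hypergraphic n q}}" using keys_add[of v w] by blast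
qed (auto simp: in_keys_iff lookup_hgp_scale)

lemma single_in_HGP: "hypergraphic n q \<Longrightarrow> Poly_Mapping.single (n, q) c \<in> HGP"
  by (auto simp: HGP_def in_keys_iff lookup_single when_def split: if_splits)

lemma HGP_subset_span:
  assumes "\<And>n q. hypergraphic n q \<Longrightarrow> Poly_Mapping.single (n, q) 1 \<in> hgp.span S"
  shows "HGP \<subseteq> hgp.span (S :: 'k::field_char_0 hgp_comb set)"
proof
  fix v :: "'k hgp_comb" assume v: "v \<in> HGP"
  have "v = (\<Sum>b\<in>Poly_Mapping.keys v. hgp_scale (Poly_Mapping.lookup v b) (Poly_Mapping.single b 1))"
    by (rule poly_mapping_eqI)
      (auto simp: lookup_sum lookup_hgp_scale lookup_single when_def in_keys_iff if_distrib cong: if_cong)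
  also have "\<dots> \<in> hgp.span S"
    using v assms by (intro hgp.span_sum hgp.span_scale) (auto simp: HGP_def)
  finally show "v \<in> hgp.span S" .
qed

lemma Psi_in_QSym:
  assumes "v \<in> (HGP :: 'k::field_char_0 hgp_comb set)"
  shows "Psi v \<in> QSym"
  unfolding Psi_def using assms
  by (intro series.subspace_sum[OF subspace_QSym])
    (auto simp: HGP_def intro!: series.subspace_scale[OF subspace_QSym] Psi_polytope_in_QSym)

text \<open>The expression of a modular relation without its covering condition, so that it also
  describes elements outside the kernel.\<close>

definition modular_comb :: "nat \<Rightarrow> nat set set \<Rightarrow> nat set set \<Rightarrow> 'k::field_char_0 hgp_comb"
  where "modular_comb n \<A> \<B> = (\<Sum>\<T>\<in>Pow \<B>.
    Poly_Mapping.single (n, family_polytope \<A> + family_polytope \<T>) ((-1) ^ card \<T>))"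

lemma modular_comb_eq:
  assumes "\<A> \<subseteq> nonempty_subsets n" "\<B> \<subseteq> nonempty_subsets n" "\<A> \<inter> \<B> = {}"
  shows "modular_comb n \<A> \<B> = (\<Sum>\<T>\<in>Pow \<B>.
    hgp_scale ((-1) ^ card \<T>) (Poly_Mapping.single (n, family_polytope (\<A> \<union> \<T>)) 1))"
  unfolding modular_comb_def
proof (rule sum.cong)
  fix \<T> assume "\<T> \<in> Pow \<B>"
  then have "family_polytope \<A> + family_polytope \<T> = family_polytope (\<A> \<union> \<T>)"
    using assms by (intro family_polytope_Un) auto
  then show "Poly_Mapping.single (n, family_polytope \<A> + family_polytope \<T>) ((-1) ^ card \<T>)
      = hgp_scale ((-1) ^ card \<T>) (Poly_Mapping.single (n, family_polytope (\<A> \<union> \<T>)) 1)"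
    by (simp add: single_eq_hgp_scale[of _ "(-1) ^ card \<T>"])
qed simp

lemma modular_comb_in_HGP:
  assumes "\<A> \<subseteq> nonempty_subsets n" "\<B> \<subseteq> nonempty_subsets n" "\<A> \<inter> \<B> = {}"
  shows "modular_comb n \<A> \<B> \<in> HGP"
  unfolding modular_comb_eq[OF assms] using assms
  by (intro hgp.subspace_sum[OF subspace_HGP] hgp.subspace_scale[OF subspace_HGP]
      single_in_HGP hypergraphic_family_polytope) auto

text \<open>This is the expansion of the product of the factors 1 - 1 over
  \<open>B \<inter> U\<close>.\<close>

lemma sum_Pow_alternating:
  assumes "finite B"
  shows "(\<Sum>T\<in>Pow B. if T \<subseteq> U then (-1) ^ card T else 0 :: 'k::comm_ring_1) = (if B \<inter> U = {} then 1 else 0)"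
proof -
  have "(\<Sum>T\<in>Pow B. if T \<subseteq> U then (-1) ^ card T else 0 :: 'k) = (\<Sum>T\<in>Pow (B \<inter> U). (-1) ^ card T)"
    using assms by (intro sum.mono_neutral_cong_right) auto
  also have "\<dots> = (\<Prod>x\<in>B \<inter> U. 1 - 1)"
    using assms by (subst prod_diff_conv_sum) auto
  finally show ?thesis using assms by (simp add: card_eq_0_iff power_0_left)
qed

text \<open>Inclusion-exclusion: the term of \<T> counts the functions whose family contains \<A>
  and \<T>, and the signs cancel every function whose family meets \<B>.\<close>

lemma Psi_modular_comb:
  assumes "\<A> \<subseteq> nonempty_subsets n" "\<B> \<subseteq> nonempty_subsets n" "\<A> \<inter> \<B> = {}"
  shows "Psi (modular_comb n \<A> \<B> :: 'k::field_char_0 hgp_comb) m = of_nat (card {f \<in> {1..n} \<rightarrow>\<^sub>E {1..}.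
    content n f = m \<and> \<A> \<subseteq> unique_min_sets n f \<and> \<B> \<inter> unique_min_sets n f = {}})"
proof -
  let ?U = "unique_min_sets n"
  define F where "F = {f \<in> {1..n} \<rightarrow>\<^sub>E {1..}. content n f = m}"
  \<comment> \<open>The empty sum is a point, for which every function is generic; this gives
    finiteness.\<close>
  have "F = generic_with n (family_polytope {}) m"
    by (simp add: F_def generic_with_hypergraphic hypergraphic_family_polytope hgp_family_family_polytope)
  then have F: "finite F" using finite_generic_with by simp
  have B: "finite \<B>" using assms(2) finite_nonempty_subsets finite_subset by blast
  have "(Psi_polytope n (family_polytope (\<A> \<union> \<T>)) :: 'k series) m
      = (\<Sum>f\<in>F. if \<A> \<subseteq> ?U f \<and> \<T> \<subseteq> ?U f then 1 else 0)" if "\<T> \<in> Pow \<B>" for \<T>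
  proof -
    have "generic_with n (family_polytope (\<A> \<union> \<T>)) m = {f \<in> F. \<A> \<subseteq> ?U f \<and> \<T> \<subseteq> ?U f}"
      using that assms by (subst generic_with_hypergraphic)
        (auto simp: F_def hypergraphic_family_polytope hgp_family_family_polytope)
    then show ?thesis using F by (simp add: Psi_polytope_def sum.If_cases Int_def)
  qed
  then have "Psi (modular_comb n \<A> \<B> :: 'k hgp_comb) m
      = (\<Sum>\<T>\<in>Pow \<B>. (-1) ^ card \<T> * (\<Sum>f\<in>F. if \<A> \<subseteq> ?U f \<and> \<T> \<subseteq> ?U f then 1 else 0))"
    unfolding modular_comb_eq[OF assms] Psi.sum Psi.scale Psi_single sum_fun_apply series_scale_def
    by (intro sum.cong) auto
  also have "\<dots> = (\<Sum>f\<in>F. if \<A> \<subseteq> ?U f then (\<Sum>\<T>\<in>Pow \<B>. if \<T> \<subseteq> ?U f then (-1) ^ card \<T> else 0) else 0)"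
    unfolding sum_distrib_left by (subst sum.swap) (auto intro!: sum.cong)
  also have "\<dots> = (\<Sum>f\<in>F. if \<A> \<subseteq> ?U f \<and> \<B> \<inter> ?U f = {} then 1 else 0)"
    unfolding sum_Pow_alternating[OF B] by (intro sum.cong) auto
  also have "\<dots> = of_nat (card {f \<in> F. \<A> \<subseteq> ?U f \<and> \<B> \<inter> ?U f = {}})"
    using F by (simp add: sum.If_cases Int_def)
  finally show ?thesis by (simp add: F_def conj_assoc)
qed

text \<open>
  The Moebius inverse of the family polytopes: its image counts the functions whose family is
  exactly \<open>\<A>\<close>, so \<open>cell n \<A>\<close> is itself a modular relation if no function has family \<open>\<A>\<close>.
\<close>

definition cell :: "nat \<Rightarrow> nat set set \<Rightarrow> 'k::field_char_0 hgp_comb"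
  where "cell n \<A> = modular_comb n \<A> (nonempty_subsets n - \<A>)"

lemma unique_min_sets_subset: "unique_min_sets n f \<subseteq> nonempty_subsets n"
  by (auto simp: unique_min_sets_def)

lemma cell_in_HGP: "\<A> \<subseteq> nonempty_subsets n \<Longrightarrow> cell n \<A> \<in> HGP"
  unfolding cell_def by (intro modular_comb_in_HGP) auto

lemma Psi_cell:
  assumes "\<A> \<subseteq> nonempty_subsets n"
  shows "Psi (cell n \<A> :: 'k::field_char_0 hgp_comb) m =
    of_nat (card {f \<in> {1..n} \<rightarrow>\<^sub>E {1..}. content n f = m \<and> unique_min_sets n f = \<A>})"
proof -
  have "\<A> \<subseteq> unique_min_sets n f \<and> (nonempty_subsets n - \<A>) \<inter> unique_min_sets n f = {} \<longleftrightarrow> unique_min_sets n f = \<A>" for f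
    using unique_min_sets_subset[of n f] assms by blast
  moreover have "nonempty_subsets n - \<A> \<subseteq> nonempty_subsets n" "\<A> \<inter> (nonempty_subsets n - \<A>) = {}"
    by auto
  ultimately show ?thesis unfolding cell_def by (simp add: Psi_modular_comb[OF assms])
qed

text \<open>The image is quasisymmetric and supported on one shape, because the family determines
  the shape. The scalar c is the coefficient at the content of f; it counts a set containing
  f.\<close>

lemma Psi_cell_unique_min_sets:
  assumes f: "f \<in> {1..n} \<rightarrow>\<^sub>E {1..}"
  obtains c where "c \<noteq> 0" "Psi (cell n (unique_min_sets n f) :: 'k::field_char_0 hgp_comb)
    = series_scale c (monomial_qsym (shape (content n f)))"
proof -
  let ?E = "cell n (unique_min_sets n f) :: 'k hgp_comb" and ?m = "content n f"
  let ?G = "\<lambda>m. {g \<in> {1..n} \<rightarrow>\<^sub>E {1..}. content n g = m \<and> unique_min_sets n g = unique_min_sets n f}"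
  note E = Psi_cell[OF unique_min_sets_subset, of n f, where 'k = 'k]
  have Q: "Psi ?E \<in> QSym" by (intro Psi_in_QSym cell_in_HGP unique_min_sets_subset)
  have pos: "0 \<notin> Poly_Mapping.keys ?m" using f by (auto simp: keys_content dest!: PiE_mem)
  show ?thesis
  proof (rule that)
    have "finite (?G ?m)"
      by (rule finite_subset[OF _ finite_generic_with[of n "family_polytope {}" ?m]])
        (auto simp: generic_with_hypergraphic hypergraphic_family_polytope hgp_family_family_polytope)
    moreover have "f \<in> ?G ?m" using f by simp
    ultimately have "0 < card (?G ?m)" unfolding card_gt_0_iff by blast
    then show "Psi ?E ?m \<noteq> 0" unfolding E by simp
    show "Psi ?E = series_scale (Psi ?E ?m) (monomial_qsym (shape ?m))"
    proof
      fix m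
      show "Psi ?E m = series_scale (Psi ?E ?m) (monomial_qsym (shape ?m)) m"
      proof (cases "0 \<notin> Poly_Mapping.keys m \<and> shape m = shape ?m")
        case True
        then have "Psi ?E m = Psi ?E ?m" using Q pos unfolding QSym_iff_shape by blast
        then show ?thesis using True by (simp add: series_scale_def monomial_qsym_def)
      next
        case False
        have "Psi ?E m = 0"
        proof (cases "0 \<in> Poly_Mapping.keys m")
          case True
          then show ?thesis using Q unfolding QSym_iff_shape by blast
        next
          case 0: False
          then have "?G m = {}" using False unique_min_sets_determine_shape by blast
          then show ?thesis unfolding E by (simp only: card.empty of_nat_0)
        qed
        then show ?thesis using False by (auto simp: series_scale_def monomial_qsym_def)
      qed
    qed
  qed
qed

lemma simple_relation_family_polytope:
  assumes q: "hypergraphic n q"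
  shows "Poly_Mapping.single (n, q) 1 - Poly_Mapping.single (n, family_polytope (hgp_family n q)) 1 \<in> simple_relations"
proof -
  have "hgp_family n q \<subseteq> nonempty_subsets n" by (auto simp: hgp_family_def)
  then show ?thesis
    using q hypergraphic_family_polytope hgp_family_family_polytope unfolding simple_relations_def by blast
qed

text \<open>A set composition outside the cover would come from a function whose family is exactly
  \<A>.\<close>

lemma cell_in_modular_relations:
  assumes A: "\<A> \<subseteq> nonempty_subsets n"
    and no: "\<And>f. f \<in> {1..n} \<rightarrow>\<^sub>E {1..} \<Longrightarrow> unique_min_sets n f \<noteq> \<A>"
  shows "cell n \<A> \<in> modular_relations"
proof -
  let ?B = "nonempty_subsets n - \<A>"
  have "\<pi> \<in> (\<Union>A\<in>\<A>. set_compositions n - Orth n A) \<union> (\<Union>B\<in>?B. Orth n B)" if \<pi>: "\<pi> \<in> set_compositions n" for \<pi>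
  proof -
    obtain f where f: "f \<in> {1..n} \<rightarrow>\<^sub>E {1..}"
      "\<And>J. J \<in> nonempty_subsets n \<Longrightarrow> \<pi> \<in> Orth n J \<longleftrightarrow> J \<in> unique_min_sets n f"
      using function_of_set_composition[OF \<pi>] by blast
    show ?thesis using no[OF f(1)] f(2) A \<pi> unique_min_sets_subset[of n f] by blast
  qed
  moreover have "Orth n B \<subseteq> set_compositions n" for B by (auto simp: Orth_def)
  ultimately have "(\<Union>A\<in>\<A>. set_compositions n - Orth n A) \<union> (\<Union>B\<in>?B. Orth n B) = set_compositions n"
    by blast
  then show ?thesis
    using A unfolding cell_def modular_comb_def modular_relations_def by blast
qed

text \<open>The permutation acts bijectively on the families disjoint from \<A> and keeps their
  sizes, so after reindexing the two alternating sums differ term by term by isomorphism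
  relations.\<close>

lemma cell_permute:
  assumes \<sigma>: "\<sigma> permutes {1..n}" and A: "\<A> \<subseteq> nonempty_subsets n"
  shows "cell n ((`) \<sigma> ` \<A>) - cell n \<A> \<in> hgp.span (isomorphism_relations :: 'k::field_char_0 hgp_comb set)"
proof -
  let ?s = "(`) ((`) \<sigma>)"
  let ?N = "nonempty_subsets n"
  have inj: "inj \<sigma>" using permutes_inj[OF \<sigma>] .
  then have injs: "inj ((`) \<sigma>)" "inj ?s" by (auto simp: inj_def inj_image_eq_iff)
  have sN: "?s \<T> \<subseteq> ?N" if "\<T> \<subseteq> ?N" for \<T>
    using that permutes_in_image[OF \<sigma>] unfolding nonempty_subsets_def by blast
  then have "?s ?N = ?N"
    using injs(1) by (intro card_subset_eq finite_nonempty_subsets) (auto intro: card_image inj_on_subset)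
  then have diff: "?N - ?s \<A> = ?s (?N - \<A>)" using injs(1) by (simp add: image_set_diff)
  have "cell n (?s \<A>) = (\<Sum>\<T>\<in>Pow (?N - ?s \<A>).
      hgp_scale ((-1) ^ card \<T>) (Poly_Mapping.single (n, family_polytope (?s \<A> \<union> \<T>)) (1 :: 'k)))"
    unfolding cell_def using sN[OF A] by (intro modular_comb_eq) auto
  also have "\<dots> = (\<Sum>\<T>\<in>Pow (?N - \<A>).
      hgp_scale ((-1) ^ card (?s \<T>)) (Poly_Mapping.single (n, family_polytope (?s \<A> \<union> ?s \<T>)) 1))"
    unfolding diff image_Pow_surj[OF refl, symmetric]
    by (rule sum.reindex_cong[of ?s]) (use injs(2) in \<open>auto intro: inj_on_subset\<close>)
  also have "\<dots> = (\<Sum>\<T>\<in>Pow (?N - \<A>).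
      hgp_scale ((-1) ^ card \<T>) (Poly_Mapping.single (n, family_polytope (?s (\<A> \<union> \<T>))) 1))"
    using injs(1) by (intro sum.cong) (auto simp: image_Un card_image inj_on_subset)
  finally have "cell n (?s \<A>) - cell n \<A> = (\<Sum>\<T>\<in>Pow (?N - \<A>). hgp_scale ((-1) ^ card \<T>)
      (Poly_Mapping.single (n, family_polytope (?s (\<A> \<union> \<T>))) (1 :: 'k) - Poly_Mapping.single (n, family_polytope (\<A> \<union> \<T>)) 1))"
    unfolding cell_def using A
    by (subst (2) modular_comb_eq) (auto simp: hgp.scale_right_diff_distrib sum_subtractf)
  also have "\<dots> \<in> hgp.span isomorphism_relations"
  proof (intro hgp.span_sum hgp.span_scale)
    fix \<T> assume "\<T> \<in> Pow (?N - \<A>)"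
    then have T: "\<A> \<union> \<T> \<subseteq> ?N" using A by auto
    note h = hypergraphic_family_polytope[OF T] hypergraphic_family_polytope[OF sN[OF T]]
    \<comment> \<open>The coordinate permutation carries the permuted family's polytope back to the
      original one, so the available relation is the negative of the wanted difference.\<close>
    have "- (Poly_Mapping.single (n, family_polytope (?s (\<A> \<union> \<T>))) (1 :: 'k) - Poly_Mapping.single (n, family_polytope (\<A> \<union> \<T>)) 1)
        \<in> isomorphism_relations"
      using h family_polytope_permute[OF \<sigma>, of "\<A> \<union> \<T>", symmetric] \<sigma>
      unfolding isomorphism_relations_def minus_diff_eq by blast
    then show "Poly_Mapping.single (n, family_polytope (?s (\<A> \<union> \<T>))) (1 :: 'k) - Poly_Mapping.single (n, family_polytope (\<A> \<union> \<T>)) 1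
        \<in> hgp.span isomorphism_relations"
      using hgp.span_base hgp.span_neg minus_minus by metis
  qed
  finally show ?thesis .
qed

text \<open>The system is unitriangular: the empty \<T> contributes the polytope of \<A> itself, and
  all other terms have strictly larger families. Hence the induction on the number of missing
  sets.\<close>

lemma family_polytope_in_span_cells:
  assumes "\<A> \<subseteq> nonempty_subsets n"
  shows "Poly_Mapping.single (n, family_polytope \<A>) (1 :: 'k::field_char_0) \<in> hgp.span (cell n ` Pow (nonempty_subsets n))"
  using assms
proof (induction "card (nonempty_subsets n - \<A>)" arbitrary: \<A> rule: less_induct)
  case less
  let ?S = "hgp.span (cell n ` Pow (nonempty_subsets n)) :: 'k hgp_comb set"
  let ?B = "nonempty_subsets n - \<A>"
  let ?t = "\<lambda>\<T>. hgp_scale ((-1) ^ card \<T>) (Poly_Mapping.single (n, family_polytope (\<A> \<union> \<T>)) (1 :: 'k))"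
  have "cell n \<A> = (\<Sum>\<T>\<in>Pow ?B. ?t \<T>)"
    unfolding cell_def using less.prems by (intro modular_comb_eq) auto
  also have "\<dots> = ?t {} + (\<Sum>\<T>\<in>Pow ?B - {{}}. ?t \<T>)"
    using finite_nonempty_subsets by (intro sum.remove) auto
  finally have "Poly_Mapping.single (n, family_polytope \<A>) 1 = cell n \<A> - (\<Sum>\<T>\<in>Pow ?B - {{}}. ?t \<T>)"
    by simp
  also have "\<dots> \<in> ?S"
  proof (intro hgp.span_diff hgp.span_sum hgp.span_scale)
    show "cell n \<A> \<in> ?S" using less.prems by (intro hgp.span_base) auto
    fix \<T> assume T: "\<T> \<in> Pow ?B - {{}}"
    then have "nonempty_subsets n - (\<A> \<union> \<T>) \<subset> ?B" by blast
    then have "card (nonempty_subsets n - (\<A> \<union> \<T>)) < card ?B"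
      using finite_nonempty_subsets by (intro psubset_card_mono) auto
    then show "Poly_Mapping.single (n, family_polytope (\<A> \<union> \<T>)) 1 \<in> ?S"
      using less T by blast
  qed
  finally show ?case .
qed

section \<open>The relations lie in the kernel\<close>

lemma generic_with_permute:
  assumes \<sigma>: "\<sigma> permutes {1..n}"
  shows "card (generic_with n ((\<lambda>x. x \<circ> \<sigma>) ` q) m) = card (generic_with n q m)"
proof -
  \<comment> \<open>Kept general in the two polytopes so that it applies to \<sigma> and to its
    inverse.\<close>
  have fwd: "f \<circ> \<tau> \<in> generic_with n q m"
    if \<tau>: "\<tau> permutes {1..n}" and gen: "generic n q (f \<circ> \<tau>) \<longleftrightarrow> generic n q' f"
      and f: "f \<in> generic_with n q' m" for f \<tau> q q'
  proof -
    have "f (\<tau> i) \<in> {1..}" if "i \<in> {1..n}" for i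
      using f permutes_in_image[OF \<tau>, of i] that by (auto simp: generic_with_def dest!: PiE_mem)
    moreover have "f (\<tau> i) = undefined" if "i \<notin> {1..n}" for i
      using f that permutes_not_in[OF \<tau> that] by (auto simp: generic_with_def PiE_def extensional_def)
    moreover have "(\<Sum>i=1..n. Poly_Mapping.single ((f \<circ> \<tau>) i) (1 :: nat)) = m"
      using f sum.permute[OF \<tau>, of "\<lambda>i. Poly_Mapping.single (f i) (1 :: nat)"]
      by (simp add: generic_with_def o_def)
    ultimately show ?thesis using f gen unfolding generic_with_def by (auto intro!: PiE_I)
  qed
  note \<rho> = permutes_inv[OF \<sigma>] and o = permutes_inv_o[OF \<sigma>]
  have "bij_betw (\<lambda>f. f \<circ> \<sigma>) (generic_with n q m) (generic_with n ((\<lambda>x. x \<circ> \<sigma>) ` q) m)"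
  proof (rule bij_betw_byWitness[where f' = "\<lambda>f. f \<circ> inv \<sigma>"])
    show "(\<lambda>f. f \<circ> \<sigma>) ` generic_with n q m \<subseteq> generic_with n ((\<lambda>x. x \<circ> \<sigma>) ` q) m"
      using fwd[OF \<sigma> generic_permute[OF \<sigma>]] by blast
    have "generic n q (f \<circ> inv \<sigma>) \<longleftrightarrow> generic n ((\<lambda>x. x \<circ> \<sigma>) ` q) f" for f
      using generic_permute[OF \<sigma>, of q "f \<circ> inv \<sigma>"] o by (simp add: comp_assoc)
    then show "(\<lambda>f. f \<circ> inv \<sigma>) ` generic_with n ((\<lambda>x. x \<circ> \<sigma>) ` q) m \<subseteq> generic_with n q m"
      using fwd[OF \<rho>] by blast
  qed (simp_all add: comp_assoc o)
  then show ?thesis by (rule bij_betw_same_card[symmetric])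
qed

lemma relations_in_kernel:
  assumes "r \<in> simple_relations \<union> modular_relations \<union> isomorphism_relations"
  shows "(r :: 'k::field_char_0 hgp_comb) \<in> HGP \<and> Psi r = 0"
proof -
  have diff: "Poly_Mapping.single (n, p) 1 - Poly_Mapping.single (n, q) (1 :: 'k) \<in> HGP \<and>
      Psi (Poly_Mapping.single (n, p) 1 - Poly_Mapping.single (n, q) (1 :: 'k)) = 0"
    if "hypergraphic n p" "hypergraphic n q" "\<And>m. card (generic_with n p m) = card (generic_with n q m)" for n p q
    using that by (intro conjI hgp.subspace_diff[OF subspace_HGP] single_in_HGP)
      (simp_all add: Psi.diff Psi_single Psi_polytope_def)
  from assms consider "r \<in> simple_relations" | "r \<in> modular_relations" | "r \<in> isomorphism_relations" by blast
  then show ?thesis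
  proof cases
    case 1
    then obtain n p q where "r = Poly_Mapping.single (n, p) 1 - Poly_Mapping.single (n, q) 1"
      "hypergraphic n p" "hypergraphic n q" "hgp_family n p = hgp_family n q"
      unfolding simple_relations_def by blast
    then show ?thesis using diff[of n p q] by (simp add: generic_with_hypergraphic)
  next
    case 2
    then obtain n \<A> \<B> where r: "r = modular_comb n \<A> \<B>"
      and AB: "\<A> \<subseteq> nonempty_subsets n" "\<B> \<subseteq> nonempty_subsets n" "\<A> \<inter> \<B> = {}"
      and cover: "(\<Union>A\<in>\<A>. set_compositions n - Orth n A) \<union> (\<Union>B\<in>\<B>. Orth n B) = set_compositions n"
      unfolding modular_relations_def mem_Collect_eq modular_comb_def[symmetric]
      by (elim exE conjE) (rule that; assumption)
    \<comment> \<open>Such a function would yield a set composition lying in none of the sets of the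
      cover.\<close>
    have no: "\<not> (\<A> \<subseteq> unique_min_sets n f \<and> \<B> \<inter> unique_min_sets n f = {})" for f
    proof -
      obtain \<pi> where \<pi>: "\<pi> \<in> set_compositions n"
        "\<And>J. J \<in> nonempty_subsets n \<Longrightarrow> \<pi> \<in> Orth n J \<longleftrightarrow> J \<in> unique_min_sets n f"
        using set_composition_of_function by blast
      then show ?thesis using cover AB(1,2) by blast
    qed
    have "Psi r m = 0" for m
    proof -
      have "{f \<in> {1..n} \<rightarrow>\<^sub>E {1..}. content n f = m \<and> \<A> \<subseteq> unique_min_sets n f \<and> \<B> \<inter> unique_min_sets n f = {}} = {}"
        using no by blast
      then show ?thesis unfolding r Psi_modular_comb[OF AB] by (simp only: card.empty of_nat_0)
    qed
    then show ?thesis using modular_comb_in_HGP[OF AB] r by (auto simp: fun_eq_iff)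
  next
    case 3
    then obtain n p q \<sigma> where "r = Poly_Mapping.single (n, p) 1 - Poly_Mapping.single (n, q) 1"
      "hypergraphic n p" "hypergraphic n q" "\<sigma> permutes {1..n}" "p = (\<lambda>x. x \<circ> \<sigma>) ` q"
      unfolding isomorphism_relations_def by blast
    then show ?thesis using diff[of n p q] generic_with_permute[of \<sigma> n q] by simp
  qed
qed

theorem theorem4:
  shows "{v \<in> (HGP :: 'k::field_char_0 hgp_comb set). Psi v = 0}
      = hgp.span (simple_relations \<union> modular_relations \<union> isomorphism_relations)
    \<and> Psi ` (HGP :: 'k hgp_comb set) = QSym"
proof -
  define R :: "'k hgp_comb set" where "R = simple_relations \<union> modular_relations \<union> isomorphism_relations"
  define C where "C = {\<alpha> :: nat list. 0 \<notin> set \<alpha>}"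
  \<comment> \<open>One representative function is fixed per composition, paired with its dimension
    because that varies with \<alpha>.\<close>
  have "\<forall>\<alpha>\<in>C. \<exists>nf. snd nf \<in> {1..fst nf} \<rightarrow>\<^sub>E {1..} \<and> shape (content (fst nf) (snd nf)) = \<alpha>"
    using shape_content_surj unfolding C_def by (metis fst_conv mem_Collect_eq snd_conv)
  then obtain P where P: "\<And>\<alpha>. \<alpha> \<in> C \<Longrightarrow> snd (P \<alpha>) \<in> {1..fst (P \<alpha>)} \<rightarrow>\<^sub>E {1..}"
    "\<And>\<alpha>. \<alpha> \<in> C \<Longrightarrow> shape (content (fst (P \<alpha>)) (snd (P \<alpha>))) = \<alpha>"
    by metis
  define E :: "nat list \<Rightarrow> 'k hgp_comb"
    where "E \<alpha> = cell (fst (P \<alpha>)) (unique_min_sets (fst (P \<alpha>)) (snd (P \<alpha>)))" for \<alpha>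
  have "\<exists>c. c \<noteq> 0 \<and> Psi (E \<alpha>) = series_scale c (monomial_qsym \<alpha>)" if "\<alpha> \<in> C" for \<alpha>
    using Psi_cell_unique_min_sets[OF P(1)[OF that]] P(2)[OF that] unfolding E_def by metis
  then obtain c where c: "\<And>\<alpha>. \<alpha> \<in> C \<Longrightarrow> c \<alpha> \<noteq> 0"
    "\<And>\<alpha>. \<alpha> \<in> C \<Longrightarrow> Psi (E \<alpha>) = series_scale (c \<alpha>) (monomial_qsym \<alpha>)"
    by metis
  have E_HGP: "E \<alpha> \<in> HGP" for \<alpha> unfolding E_def by (intro cell_in_HGP unique_min_sets_subset)

  have cell: "cell n \<A> \<in> hgp.span (R \<union> E ` C)" if A: "\<A> \<subseteq> nonempty_subsets n" for n \<A>
  proof (cases "\<exists>f\<in>{1..n} \<rightarrow>\<^sub>E {1..}. unique_min_sets n f = \<A>")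
    case False
    then have "(cell n \<A> :: 'k hgp_comb) \<in> modular_relations" using A by (intro cell_in_modular_relations) auto
    then show ?thesis by (intro hgp.span_base) (simp add: R_def)
  next
    case True
    then obtain f where f: "unique_min_sets n f = \<A>" by blast
    let ?\<alpha> = "shape (content n f)"
    have \<alpha>: "?\<alpha> \<in> C" by (simp add: C_def zero_notin_shape)
    \<comment> \<open>The parts of a shape sum to the dimension, so the representative lives in the
      same space as f.\<close>
    have n: "fst (P ?\<alpha>) = n" using P(2)[OF \<alpha>] sum_list_shape_content by metis
    obtain \<sigma> where "\<sigma> permutes {1..n}" "\<A> = (`) \<sigma> ` unique_min_sets n (snd (P ?\<alpha>))"
      using shape_eq_imp_permuted[of n "snd (P ?\<alpha>)" f] P(2)[OF \<alpha>] n f by metis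
    then have "cell n \<A> - E ?\<alpha> \<in> hgp.span isomorphism_relations"
      unfolding E_def n using cell_permute[OF _ unique_min_sets_subset] by simp
    then have "cell n \<A> - E ?\<alpha> \<in> hgp.span (R \<union> E ` C)"
      by (rule rev_subsetD) (intro hgp.span_mono, auto simp: R_def)
    moreover have "E ?\<alpha> \<in> hgp.span (R \<union> E ` C)" using \<alpha> by (intro hgp.span_base) blast
    ultimately have "(cell n \<A> - E ?\<alpha>) + E ?\<alpha> \<in> hgp.span (R \<union> E ` C)" by (rule hgp.span_add)
    then show ?thesis by simp
  qed
  have "Poly_Mapping.single (n, q) 1 \<in> hgp.span (R \<union> E ` C)" if q: "hypergraphic n q" for n q
  proof -
    let ?p = "family_polytope (hgp_family n q)"
    have "hgp.span (cell n ` Pow (nonempty_subsets n)) \<subseteq> hgp.span (R \<union> E ` C)"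
      using cell by (intro hgp.span_minimal hgp.subspace_span) auto
    then have "Poly_Mapping.single (n, ?p) 1 \<in> hgp.span (R \<union> E ` C)"
      using family_polytope_in_span_cells[of "hgp_family n q" n] by (auto simp: hgp_family_def)
    moreover have "Poly_Mapping.single (n, q) 1 - Poly_Mapping.single (n, ?p) 1 \<in> hgp.span (R \<union> E ` C)"
      by (intro hgp.span_base) (simp add: R_def simple_relation_family_polytope[OF q])
    ultimately have "(Poly_Mapping.single (n, q) 1 - Poly_Mapping.single (n, ?p) 1) + Poly_Mapping.single (n, ?p) 1
        \<in> hgp.span (R \<union> E ` C)"
      by (intro hgp.span_add)
    then show ?thesis by simp
  qed
  then have HGP: "HGP \<subseteq> hgp.span (R \<union> E ` C)" by (rule HGP_subset_span)

  have "R \<subseteq> {v \<in> HGP. Psi v = 0}" using relations_in_kernel unfolding R_def by blast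
  moreover have "hgp.subspace {v \<in> (HGP :: 'k hgp_comb set). Psi v = 0}"
    using subspace_HGP by (auto simp: hgp.subspace_def Psi.add Psi.scale)
  ultimately have span_R: "hgp.span R \<subseteq> {v \<in> HGP. Psi v = 0}" by (rule hgp.span_minimal)

  have inj: "w = 0" if w: "w \<in> hgp.span (E ` C)" and Psi_w: "Psi w = 0" for w
  proof -
    from w obtain t a where t: "finite t" "t \<subseteq> E ` C" and w_eq: "w = (\<Sum>e\<in>t. hgp_scale (a e) e)"
      unfolding hgp.span_explicit by blast
    have "a e = 0" if e: "e \<in> t" for e
    proof -
      from e t obtain \<alpha> where \<alpha>: "\<alpha> \<in> C" "e = E \<alpha>" by blast
      obtain n f where nf: "f \<in> {1..n} \<rightarrow>\<^sub>E {1..}" "shape (content n f) = \<alpha>"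
        using shape_content_surj \<alpha>(1) unfolding C_def by blast
      let ?m = "content n f"
      \<comment> \<open>Evaluation at a monomial of shape \<alpha> isolates
        \<open>E \<alpha>\<close> among the representatives, which gives linear independence of the
        images.\<close>
      have m: "monomial_qsym \<beta> ?m = (if \<beta> = \<alpha> then 1 else 0 :: 'k)" for \<beta>
        using nf by (auto simp: monomial_qsym_def keys_content dest!: PiE_mem)
      have "Psi e' ?m = 0" if "e' \<in> t - {e}" for e'
      proof -
        from that t obtain \<beta> where "\<beta> \<in> C" "e' = E \<beta>" "\<beta> \<noteq> \<alpha>" using \<alpha> by blast
        then show ?thesis using c(2) m by (simp add: series_scale_def)
      qed
      then have "Psi w ?m = a e * Psi e ?m"
        unfolding w_eq Psi.sum Psi.scale sum_fun_apply series_scale_def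
        using t(1) e by (subst sum.remove[of _ e]) auto
      also have "Psi e ?m = c \<alpha>" using \<alpha> c(2) m by (simp add: series_scale_def)
      finally show ?thesis using c(1)[OF \<alpha>(1)] Psi_w by simp
    qed
    then show ?thesis unfolding w_eq by simp
  qed

  have "{v \<in> HGP. Psi v = 0} \<subseteq> hgp.span R"
  proof
    fix v :: "'k hgp_comb" assume v: "v \<in> {v \<in> HGP. Psi v = 0}"
    then have "v \<in> hgp.span (R \<union> E ` C)" using HGP by blast
    \<comment> \<open>Since r already lies in the kernel, so does w, and independence forces w =
      0.\<close>
    then obtain r w where rw: "v = r + w" "r \<in> hgp.span R" "w \<in> hgp.span (E ` C)"
      unfolding hgp.span_Un by blast
    then have "Psi w = 0" using v span_R by (auto simp: Psi.add)
    then show "v \<in> hgp.span R" using inj[OF rw(3)] rw(1,2) by simp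
  qed
  moreover have "QSym \<subseteq> Psi ` (HGP :: 'k hgp_comb set)"
  proof
    fix F :: "'k series" assume "F \<in> QSym"
    then obtain K b where K: "\<And>\<alpha>. \<alpha> \<in> K \<Longrightarrow> 0 \<notin> set \<alpha>"
      and F: "F = (\<Sum>\<alpha>\<in>K. series_scale (b \<alpha>) (monomial_qsym \<alpha>))"
      by (rule QSym_expand) (rule that)
    \<comment> \<open>Dividing by the nonzero \<open>c \<alpha>\<close> normalizes each image to the
      monomial quasisymmetric function.\<close>
    have "F = Psi (\<Sum>\<alpha>\<in>K. hgp_scale (b \<alpha> / c \<alpha>) (E \<alpha>))"
      unfolding F Psi.sum Psi.scale using K c by (intro sum.cong) (auto simp: C_def series_scale_def)
    moreover have "(\<Sum>\<alpha>\<in>K. hgp_scale (b \<alpha> / c \<alpha>) (E \<alpha>)) \<in> HGP"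
      by (intro hgp.subspace_sum[OF subspace_HGP] hgp.subspace_scale[OF subspace_HGP] E_HGP)
    ultimately show "F \<in> Psi ` HGP" by blast
  qed
  ultimately show ?thesis
    using span_R Psi_in_QSym unfolding R_def by (intro conjI equalityI) auto
qed

end
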